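(* Let $D\subseteq\mathbb{C}$ be a domain, let $a_1,a_2,a_3,a_4\in\mathbb{C}_\infty$ be four distinct values, and let $\mathcal{F}$ and $\mathcal{G}$ be two families of meromorphic functions on $D$ such that, for each $f\in\mathcal{F}$, every $a_1$-point of $f$ has multiplicity at least $2$ and every $a_2$-point of $f$ has multiplicity at least $3$. Suppose that $\mathcal{G}$ is normal in $D$. If for each $f\in\mathcal{F}$ there exists $g\in\mathcal{G}$ such that $f$ and $g$ share $a_3$ and $a_4$ partially in $D$, then $\mathcal{F}$ is normal in $D$.
   Context: $\mathbb{C}_\infty=\mathbb{C}\cup\{\infty\}$ is the extended complex plane. A family of meromorphic functions on $D$ is normal in $D$ if every sequence in the family has a subsequence converging spherically locally uniformly in $D$; the limit is either a meromorphic function on $D$ or identically equal to $\infty$. For a meromorphic function $f$ on $D$ and $a\in\mathbb{C}_\infty$, an $a$-point of $f$ is a point $z\in D$ with $f(z)=a$, and $\bar{E}(f,a)=\{z\in D: f(z)=a\}$ (multiplicities ignored). Two meromorphic functions $f,g$ on $D$ are said to share $a$ partially if $\bar{E}(f,a)\subseteq\bar{E}(g,a)$ (in this order: every $a$-point of $f$ is an $a$-point of $g$). *)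

theory Defs
  imports "HOL-Complex_Analysis.Complex_Analysis" "HOL-Library.Extended_Nat"
begin

section \<open>The extended complex plane with the chordal metric\<close>

datatype ext_complex = Finite complex | Infty

text \<open>Inverse stereographic projection onto the unit sphere of \<open>complex \<times> real\<close>.\<close>

definition stereo :: "ext_complex \<Rightarrow> complex \<times> real" where
  "stereo p = (case p of
      Finite z \<Rightarrow> (of_real (2 / (1 + (norm z)\<^sup>2)) * z, ((norm z)\<^sup>2 - 1) / ((norm z)\<^sup>2 + 1))
    | Infty \<Rightarrow> (0, 1))"

lemma stereo_eq_iff: "stereo p = stereo q \<longleftrightarrow> p = q"
proof
  have pos: "1 + (norm z)\<^sup>2 > 0" for z :: complex
    by (simp add: add_pos_nonneg)
  have less1: "((norm z)\<^sup>2 - 1) / ((norm z)\<^sup>2 + 1) < 1" for z :: complex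
    using pos[of z] by (simp add: divide_simps)
  have inj: "z = w" if "stereo (Finite z) = stereo (Finite w)" for z w
  proof -
    have "((norm z)\<^sup>2 - 1) / ((norm z)\<^sup>2 + 1) = ((norm w)\<^sup>2 - 1) / ((norm w)\<^sup>2 + 1)"
      using that by (simp add: stereo_def)
    hence "((norm z)\<^sup>2 - 1) * ((norm w)\<^sup>2 + 1) = ((norm w)\<^sup>2 - 1) * ((norm z)\<^sup>2 + 1)"
      using pos[of z] pos[of w] by (simp add: frac_eq_eq)
    hence eq: "(norm z)\<^sup>2 = (norm w)\<^sup>2"
      by (simp add: algebra_simps)
    have "2 / (1 + (norm w)\<^sup>2) \<noteq> 0"
      using pos[of w] by simp
    moreover have "of_real (2 / (1 + (norm w)\<^sup>2)) * z = of_real (2 / (1 + (norm w)\<^sup>2)) * w"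
      using that eq unfolding stereo_def by simp
    ultimately show ?thesis
      by (metis mult_left_cancel of_real_eq_0_iff)
  qed
  assume eq: "stereo p = stereo q"
  show "p = q"
  proof (cases p; cases q)
    fix z assume "p = Finite z" "q = Infty"
    thus ?thesis using eq less1[of z] by (simp add: stereo_def)
  next
    fix z assume "p = Infty" "q = Finite z"
    thus ?thesis using eq less1[of z] by (simp add: stereo_def)
  qed (use eq inj in auto)
qed auto

instantiation ext_complex :: metric_space
begin

definition dist_ext_complex_def:
  "dist (p::ext_complex) q = dist (stereo p) (stereo q)"

definition uniformity_ext_complex_def:
  "(uniformity :: (ext_complex \<times> ext_complex) filter) = (INF e\<in>{0<..}. principal {(x::ext_complex, y). dist x y < e})"

definition open_ext_complex_def:
  "open (U::ext_complex set) \<longleftrightarrow> (\<forall>x\<in>U. eventually (\<lambda>(x', y). x' = x \<longrightarrow> y \<in> U) uniformity)"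

instance
proof
  fix p q r :: ext_complex
  show "dist p q = 0 \<longleftrightarrow> p = q"
    by (simp add: dist_ext_complex_def stereo_eq_iff)
  show "dist p q \<le> dist p r + dist q r"
    unfolding dist_ext_complex_def by (rule dist_triangle2)
qed (simp_all only: uniformity_ext_complex_def open_ext_complex_def)

end

lemma dist_Finite_Infty: "dist (Finite z) Infty = 2 / sqrt (1 + (norm z)\<^sup>2)"
proof -
  define n where "n = (norm z)\<^sup>2"
  have n: "n \<ge> 0" "1 + n > 0" by (simp_all add: n_def add_pos_nonneg)
  have nm: "norm (of_real (2 / (1 + n)) * z) = 2 / (1 + n) * norm z"
    using n by (simp only: norm_mult norm_of_real) simp
  have "(dist (Finite z) Infty)\<^sup>2 = (2 / (1 + n) * norm z)\<^sup>2 + ((n - 1) / (n + 1) - 1)\<^sup>2"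
    unfolding dist_ext_complex_def stereo_def ext_complex.case dist_Pair_Pair n_def[symmetric]
    by (simp only: dist_norm[of _ "0::complex"] diff_zero nm) (simp add: dist_real_def)
  also have "\<dots> = (2 / (1 + n))\<^sup>2 * n + ((n - 1) / (n + 1) - 1)\<^sup>2"
    by (simp only: power_mult_distrib n_def)
  also have "\<dots> = (2 / sqrt (1 + n))\<^sup>2"
    using n by (simp add: power_divide divide_simps power2_eq_square) algebra
  finally show ?thesis
    unfolding n_def by (rule power2_eq_imp_eq) auto
qed

lemma dist_Finite_Finite:
  "dist (Finite z) (Finite w)
     = 2 * norm (z - w) / (sqrt (1 + (norm z)\<^sup>2) * sqrt (1 + (norm w)\<^sup>2))"
proof -
  define m n k where "m = (norm z)\<^sup>2" and "n = (norm w)\<^sup>2" and "k = (norm (z - w))\<^sup>2"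
  have pos: "1 + m > 0" "1 + n > 0" by (simp_all add: m_def n_def add_pos_nonneg)
  have k: "k = m + n - 2 * (z \<bullet> w)"
    by (simp add: k_def m_def n_def power2_norm_eq_inner inner_diff inner_commute)
  have "(dist (of_real (2 / (1 + m)) * z) (of_real (2 / (1 + n)) * w))\<^sup>2
          = (norm ((2 / (1 + m)) *\<^sub>R z - (2 / (1 + n)) *\<^sub>R w))\<^sup>2"
    by (simp only: dist_norm scaleR_conv_of_real)
  also have "\<dots> = (2 / (1 + m))\<^sup>2 * m + (2 / (1 + n))\<^sup>2 * n - 2 * (2 / (1 + m)) * (2 / (1 + n)) * (z \<bullet> w)"
    unfolding m_def n_def
    by (simp only: power2_norm_eq_inner inner_diff inner_scaleR_left inner_scaleR_right inner_commute[of w z])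
       (simp add: power2_eq_square algebra_simps)
  finally have d: "(dist (of_real (2 / (1 + m)) * z) (of_real (2 / (1 + n)) * w))\<^sup>2 = \<dots>" .
  have "(dist (Finite z) (Finite w))\<^sup>2
      = (dist (of_real (2 / (1 + m)) * z) (of_real (2 / (1 + n)) * w))\<^sup>2
          + ((m - 1) / (m + 1) - (n - 1) / (n + 1))\<^sup>2"
    unfolding dist_ext_complex_def stereo_def ext_complex.case dist_Pair_Pair m_def n_def
    by (simp add: dist_real_def)
  also have "\<dots> = 4 * k / ((1 + m) * (1 + n))"
    unfolding d k using pos by (simp add: divide_simps power2_eq_square) algebra
  also have "\<dots> = (2 * norm (z - w) / (sqrt (1 + m) * sqrt (1 + n)))\<^sup>2"
    using pos by (simp add: power_divide power_mult_distrib k_def)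
  finally show ?thesis
    unfolding m_def n_def by (rule power2_eq_imp_eq) auto
qed


section \<open>Meromorphic functions, a-points, multiplicities\<close>

text \<open>
  A meromorphic function on an open set is a \<open>f :: complex \<Rightarrow> complex\<close> with
  \<open>f nicely_meromorphic_on D\<close>: removable singularities are filled in, and the placeholder
  value \<open>0\<close> that the library uses at poles is replaced by the true value here.
\<close>

definition ext_val :: "(complex \<Rightarrow> complex) \<Rightarrow> complex \<Rightarrow> ext_complex" where
  "ext_val f z = (if is_pole f z then Infty else Finite (f z))"

definition a_points :: "complex set \<Rightarrow> (complex \<Rightarrow> complex) \<Rightarrow> ext_complex \<Rightarrow> complex set" where
  "a_points D f a = {z\<in>D. ext_val f z = a}"

text \<open>
  Only meaningful at a-points of \<open>f\<close>. If \<open>f\<close> is constantly \<open>a\<close> near \<open>z\<close>, the order of vanishing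
  is infinite; \<^const>\<open>zorder\<close> is unspecified in that case.
\<close>

definition a_point_mult :: "(complex \<Rightarrow> complex) \<Rightarrow> ext_complex \<Rightarrow> complex \<Rightarrow> enat" where
  "a_point_mult f a z = (case a of
      Finite c \<Rightarrow> (if \<forall>\<^sub>F w in at z. f w = c then \<infinity> else enat (nat (zorder (\<lambda>w. f w - c) z)))
    | Infty \<Rightarrow> enat (nat (- zorder f z)))"

definition shares_partially ::
    "complex set \<Rightarrow> (complex \<Rightarrow> complex) \<Rightarrow> (complex \<Rightarrow> complex) \<Rightarrow> ext_complex \<Rightarrow> bool" where
  "shares_partially D f g a \<longleftrightarrow> a_points D f a \<subseteq> a_points D g a"


section \<open>Normal families\<close>

definition spherically_locally_uniform_limit ::
    "complex set \<Rightarrow> (nat \<Rightarrow> complex \<Rightarrow> complex) \<Rightarrow> (complex \<Rightarrow> ext_complex) \<Rightarrow> bool" where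
  "spherically_locally_uniform_limit D fs \<phi> \<longleftrightarrow>
     (\<forall>z\<in>D. \<exists>U. open U \<and> z \<in> U \<and> U \<subseteq> D \<and>
        uniform_limit U (\<lambda>n. ext_val (fs n)) \<phi> sequentially)"

definition normal_family :: "complex set \<Rightarrow> (complex \<Rightarrow> complex) set \<Rightarrow> bool" where
  "normal_family D F \<longleftrightarrow>
     (\<forall>fs :: nat \<Rightarrow> complex \<Rightarrow> complex. range fs \<subseteq> F \<longrightarrow>
       (\<exists>r \<phi>. strict_mono r \<and> spherically_locally_uniform_limit D (fs \<circ> r) \<phi> \<and>
         ((\<exists>h. h nicely_meromorphic_on D \<and> (\<forall>z\<in>D. \<phi> z = ext_val h z)) \<or>
          (\<forall>z\<in>D. \<phi> z = Infty))))"

end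

(*
  A limit of functions from G cannot take both values a3 and a4 at a given point z, so in a
  subsequence for which the functions of G converge, the functions of F eventually omit one of these
  values, say a, in a disc around z. It remains to bound the spherical derivative of functions that
  omit a and take a1 with multiplicity at least 2 and a2 with multiplicity at least 3.

  After a Moebius transformation, a1, a2, a become 0, 1, infinity and the function becomes a
  holomorphic k. Since 1/2 + 2/3 > 1, the plane carries a metric with cone points at 0 and 1 of
  exponents 9/20 < 1/2 and 3/5 < 2/3, with a third cone point at infinity of exponent 39/40 < 1, and
  with curvature bounded above by a negative constant. The multiplicities make its pullback under k vanish
  continuously at the 0-points and 1-points of k, so Ahlfors' form of the Schwarz lemma applies; the
  maximum in its proof is attained at a point where everything is smooth. This bounds the spherical
  derivative of k locally uniformly, hence the family is locally spherically equi-Lipschitz. The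
  usual diagonal argument gives a locally uniform limit, which is locally a Moebius transform of a
  limit of bounded holomorphic functions.
*)

theory Submission
  imports Defs
begin

text \<open>The model is the hyperbolic sphere with orbifold points of orders 2 and 3 and a
  puncture, whose density has the exponents 1 - 1/2 and 1 - 1/3. With these critical exponents the
  pullback stays positive at an exact double zero or triple 1-point, so a maximum there would need
  an argument of its own; smaller exponents rule it out. Their sum must still exceed 1, which leaves
  a window of width 1/6, and \<open>9/20 + 3/5 = 1 + 1/20\<close> lies in it, so
  \<open>a = 1/20\<close>. The power \<open>1/4\<close> in the density is forced at infinity. There
  the Laplacian of the logarithm of the density decays like |w|^(-2 - a), while the square of the
  density with a power t in place of \<open>1/4\<close> decays like |w|^(-2 - 2a + 4ta). The
  curvature bound needs t <= 1/4. Multiplicities enter the analysis only as bounds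
  \<open>dist (ext_val f w) a \<le> C * norm (w - z) ^ n\<close>. This form treats poles like other
  a-points, passes through Moebius maps because they are bi-Lipschitz for the chordal metric, and
  covers locally constant functions, whose multiplicity is infinite.\<close>

section \<open>The Laplacian along the coordinate lines\<close>

text \<open>
  The Laplacian is read off as the second derivative at \<open>0\<close> of \<open>t \<mapsto> \<psi> (z + t) + \<psi> (z + \<i> t)\<close>. The factor
  \<open>1\<close> gives both summands the shape \<open>\<psi> (z + e * t)\<close>.
\<close>

definition has_laplacian :: "(complex \<Rightarrow> real) \<Rightarrow> real \<Rightarrow> complex \<Rightarrow> bool" where
  "has_laplacian \<psi> L z \<longleftrightarrow> (\<exists>g.
     (\<forall>\<^sub>F t in nhds 0. ((\<lambda>t. \<psi> (z + 1 * of_real t) + \<psi> (z + \<i> * of_real t))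
        has_real_derivative g t) (at t)) \<and>
     (g has_real_derivative L) (at 0))"

lemma has_laplacian_add:
  assumes "has_laplacian \<psi> L z" "has_laplacian \<eta> K z"
  shows "has_laplacian (\<lambda>w. \<psi> w + \<eta> w) (L + K) z"
proof -
  from assms obtain g h where
    g: "\<forall>\<^sub>F t in nhds 0. ((\<lambda>t. \<psi> (z + 1 * of_real t) + \<psi> (z + \<i> * of_real t)) has_real_derivative g t) (at t)"
      "(g has_real_derivative L) (at 0)" and
    h: "\<forall>\<^sub>F t in nhds 0. ((\<lambda>t. \<eta> (z + 1 * of_real t) + \<eta> (z + \<i> * of_real t)) has_real_derivative h t) (at t)"
      "(h has_real_derivative K) (at 0)"
    unfolding has_laplacian_def by blast
  have "\<forall>\<^sub>F t in nhds 0. ((\<lambda>t. (\<psi> (z + 1 * of_real t) + \<eta> (z + 1 * of_real t)) +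
      (\<psi> (z + \<i> * of_real t) + \<eta> (z + \<i> * of_real t))) has_real_derivative g t + h t) (at t)"
    using g(1) h(1)
  proof eventually_elim
    case (elim t)
    show ?case using DERIV_add[OF elim] by (simp add: algebra_simps)
  qed
  moreover have "((\<lambda>t. g t + h t) has_real_derivative L + K) (at 0)"
    using g(2) h(2) by (rule DERIV_add)
  ultimately show ?thesis unfolding has_laplacian_def by (intro exI conjI)
qed

lemma has_laplacian_cmult:
  assumes "has_laplacian \<psi> L z"
  shows "has_laplacian (\<lambda>w. c * \<psi> w) (c * L) z"
proof -
  from assms obtain g where
    g: "\<forall>\<^sub>F t in nhds 0. ((\<lambda>t. \<psi> (z + 1 * of_real t) + \<psi> (z + \<i> * of_real t)) has_real_derivative g t) (at t)"
      "(g has_real_derivative L) (at 0)"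
    unfolding has_laplacian_def by blast
  have "\<forall>\<^sub>F t in nhds 0. ((\<lambda>t. c * \<psi> (z + 1 * of_real t) + c * \<psi> (z + \<i> * of_real t))
      has_real_derivative c * g t) (at t)"
    using g(1)
  proof eventually_elim
    case (elim t)
    show ?case using DERIV_cmult[OF elim, of c] by (simp add: algebra_simps)
  qed
  moreover have "((\<lambda>t. c * g t) has_real_derivative c * L) (at 0)"
    using g(2) by (rule DERIV_cmult)
  ultimately show ?thesis unfolding has_laplacian_def by (intro exI conjI)
qed

lemma has_real_derivative_Re_line:
  assumes "(F has_field_derivative F') (at (z + e * of_real t))"
  shows "((\<lambda>t. Re (F (z + e * of_real t))) has_real_derivative Re (F' * e)) (at t)"
proof -
  have "((\<lambda>t. F (z + e * of_real t)) has_vector_derivative (e * F')) (at t)"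
  proof -
    have "((\<lambda>t. z + e * complex_of_real t) has_vector_derivative e * 1) (at t)"
      unfolding has_vector_derivative_def
      by (auto intro!: derivative_eq_intros simp: scaleR_conv_of_real)
    with assms show ?thesis
      using field_vector_diff_chain_at[of "\<lambda>t. z + e * of_real t" e t F F'] by (simp add: o_def)
  qed
  hence "((\<lambda>t. Re (F (z + e * of_real t))) has_vector_derivative Re (e * F')) (at t)"
    by (rule bounded_linear.has_vector_derivative[OF bounded_linear_Re])
  thus ?thesis by (simp add: has_real_derivative_iff_has_vector_derivative mult.commute)
qed

lemma eventually_line_in_open:
  fixes z e :: complex
  assumes "open S" "z \<in> S"
  shows "\<forall>\<^sub>F t in nhds (0::real). z + e * of_real t \<in> S"
proof -
  have "((\<lambda>t::real. z + e * complex_of_real t) \<longlongrightarrow> z + e * of_real 0) (nhds 0)"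
    by (intro tendsto_intros filterlim_ident)
  thus ?thesis using assms by (auto dest: topological_tendstoD)
qed

text \<open>In direction e the second derivative is s'' Re(F' e)^2 + s' Re(F'' e^2). Summing over e
  = 1 and e = i cancels the second term, as i^2 = -1, and turns the first into s'' |F'|^2. With s
  the identity this is harmonicity of Re F.\<close>

lemma has_laplacian_compose_Re:
  assumes "F holomorphic_on S" "open S" "z \<in> S"
    and s1: "\<And>x. (s has_real_derivative s' x) (at x)"
    and s2: "\<And>x. (s' has_real_derivative s'' x) (at x)"
  shows "has_laplacian (\<lambda>w. s (Re (F w))) (s'' (Re (F z)) * (norm (deriv F z))\<^sup>2) z"
proof -
  define G where "G e t = s' (Re (F (z + e * of_real t))) * Re (deriv F (z + e * of_real t) * e)" for e t
  have D: "((\<lambda>t. s (Re (F (z + e * of_real t)))) has_real_derivative G e t) (at t)"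
    if "z + e * of_real t \<in> S" for e t
  proof -
    have "(F has_field_derivative deriv F (z + e * of_real t)) (at (z + e * of_real t))"
      using assms(1,2) that by (rule holomorphic_derivI)
    from DERIV_chain2[OF s1 has_real_derivative_Re_line[OF this]]
    show ?thesis unfolding G_def .
  qed
  have "\<forall>\<^sub>F t in nhds 0. ((\<lambda>t. s (Re (F (z + 1 * of_real t))) + s (Re (F (z + \<i> * of_real t))))
      has_real_derivative G 1 t + G \<i> t) (at t)"
    using eventually_line_in_open[OF assms(2,3), of 1] eventually_line_in_open[OF assms(2,3), of \<i>]
    by eventually_elim (intro DERIV_add D)
  moreover have D2: "(G e has_real_derivative
      (s'' (Re (F z)) * Re (deriv F z * e)) * Re (deriv F z * e)
       + Re (deriv (deriv F) z * e * e) * s' (Re (F z))) (at 0)" for e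
  proof -
    have F: "(F has_field_derivative deriv F (z + e * of_real 0)) (at (z + e * of_real 0))"
      using holomorphic_derivI[OF assms(1,2,3)] by simp
    have F2: "((\<lambda>w. deriv F w * e) has_field_derivative (deriv (deriv F) z * e)) (at (z + e * of_real 0))"
      using holomorphic_derivI[OF holomorphic_deriv[OF assms(1,2)] assms(2,3)]
      by (auto intro!: derivative_eq_intros)
    have "((\<lambda>t. s' (Re (F (z + e * of_real t)))) has_real_derivative
        s'' (Re (F (z + e * of_real 0))) * Re (deriv F (z + e * of_real 0) * e)) (at 0)"
      by (rule DERIV_chain2[OF s2 has_real_derivative_Re_line[OF F]])
    from DERIV_mult[OF this has_real_derivative_Re_line[OF F2]]
    show ?thesis unfolding G_def by (simp add: mult.assoc)
  qed
  have "((\<lambda>t. G 1 t + G \<i> t) has_real_derivative s'' (Re (F z)) * (norm (deriv F z))\<^sup>2) (at 0)"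
  proof -
    have n: "(norm (deriv F z))\<^sup>2 = (Re (deriv F z))\<^sup>2 + (Im (deriv F z))\<^sup>2"
      by (simp add: cmod_power2)
    show ?thesis using DERIV_add[OF D2[of 1] D2[of \<i>]] unfolding n
      by (simp add: power2_eq_square algebra_simps)
  qed
  ultimately show ?thesis unfolding has_laplacian_def by (intro exI conjI)
qed

text \<open>Up to an additive constant the function is minus the logarithm of the Poincare density
  2r / (r^2 - |w - c|^2), so the value expresses that this metric has curvature -1.\<close>

lemma has_laplacian_ln_disc:
  assumes "norm (z - c) < r"
  shows "has_laplacian (\<lambda>w. ln (r\<^sup>2 - (norm (w - c))\<^sup>2)) (- (4 * r\<^sup>2 / (r\<^sup>2 - (norm (z - c))\<^sup>2)\<^sup>2)) z"
proof -
  have r: "r > 0" using assms by (meson norm_ge_zero order_le_less_trans)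
  define b where "b = (\<lambda>e. Re ((z - c) * cnj e))"
  define D where "D = r\<^sup>2 - (norm (z - c))\<^sup>2"
  have Dpos: "D > 0" using power_strict_mono[OF assms, of 2] unfolding D_def by simp
  \<comment> \<open>Along a unit direction the argument of the logarithm is a quadratic polynomial
    in t, which reduces everything to one-variable calculus.\<close>
  have expand: "r\<^sup>2 - (norm (z + e * of_real t - c))\<^sup>2 = D - 2 * b e * t - t\<^sup>2" if "norm e = 1" for e :: complex and t
  proof -
    have "(norm (z + e * of_real t - c))\<^sup>2 = (norm ((z - c) + e * of_real t))\<^sup>2"
      by (simp add: algebra_simps)
    also have "\<dots> = (norm (z - c))\<^sup>2 + (norm (e * of_real t))\<^sup>2 + 2 * ((z - c) \<bullet> (e * of_real t))"
      by (simp add: power2_norm_eq_inner inner_add inner_commute)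
    also have "(norm (e * of_real t))\<^sup>2 = t\<^sup>2" using that by (simp add: norm_mult)
    also have "(z - c) \<bullet> (e * of_real t) = t * b e"
      by (simp add: b_def inner_complex_def algebra_simps)
    finally show ?thesis by (simp add: D_def)
  qed
  have ev: "\<forall>\<^sub>F t in nhds (0::real). D - 2 * b e * t - t\<^sup>2 > 0" for e
  proof -
    have "((\<lambda>t::real. D - 2 * b e * t - t\<^sup>2) \<longlongrightarrow> D - 2 * b e * 0 - 0\<^sup>2) (nhds 0)"
      by (intro tendsto_intros filterlim_ident)
    from order_tendstoD(1)[OF this, of 0] Dpos show ?thesis by simp
  qed
  define g where "g e t = (- 2 * b e - 2 * t) / (D - 2 * b e * t - t\<^sup>2)" for e t
  have "\<forall>\<^sub>F t in nhds 0. ((\<lambda>t. ln (r\<^sup>2 - (norm (z + 1 * of_real t - c))\<^sup>2) +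
        ln (r\<^sup>2 - (norm (z + \<i> * of_real t - c))\<^sup>2)) has_real_derivative g 1 t + g \<i> t) (at t)"
    using ev[of 1] ev[of \<i>]
  proof eventually_elim
    case (elim t)
    show ?case unfolding expand[of 1, simplified norm_one, OF refl] expand[of \<i>, simplified norm_ii, OF refl] g_def
      using elim by (auto intro!: derivative_eq_intros simp: divide_simps)
  qed
  moreover have "((\<lambda>t. g 1 t + g \<i> t) has_real_derivative - (4 * r\<^sup>2 / D\<^sup>2)) (at 0)"
  proof -
    have Dg: "(g e has_real_derivative (- 2 * D - (2 * b e)\<^sup>2) / D\<^sup>2) (at 0)" for e
      unfolding g_def using Dpos
      by (auto intro!: derivative_eq_intros simp: power2_eq_square)
    have "(b 1)\<^sup>2 + (b \<i>)\<^sup>2 = (norm (z - c))\<^sup>2"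
      unfolding b_def cmod_power2 by (simp add: power2_eq_square)
    hence "(- 2 * D - (2 * b 1)\<^sup>2) + (- 2 * D - (2 * b \<i>)\<^sup>2) = - (4 * r\<^sup>2)"
      by (simp add: D_def power_mult_distrib)
    hence "(- 2 * D - (2 * b 1)\<^sup>2) / D\<^sup>2 + (- 2 * D - (2 * b \<i>)\<^sup>2) / D\<^sup>2 = - (4 * r\<^sup>2 / D\<^sup>2)"
      by (metis add_divide_distrib minus_divide_left)
    thus ?thesis using DERIV_add[OF Dg[of 1] Dg[of \<i>]] by simp
  qed
  ultimately show ?thesis unfolding has_laplacian_def D_def[symmetric] by (intro exI conjI)
qed

text \<open>A local maximum forces \<open>g 0 = 0\<close>. If L were positive, g would be positive
  just to the right of 0, and the mean value theorem would make the function increase there. Only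
  differentiability of g at the single point 0 is used.\<close>

lemma has_laplacian_local_max:
  assumes "has_laplacian \<psi> L z" "\<forall>\<^sub>F w in nhds z. \<psi> w \<le> \<psi> z"
  shows "L \<le> 0"
proof (rule ccontr)
  assume "\<not> L \<le> 0"
  hence L: "L > 0" by simp
  define \<Phi> where "\<Phi> t = \<psi> (z + 1 * of_real t) + \<psi> (z + \<i> * of_real t)" for t
  from assms(1) obtain g where g: "\<forall>\<^sub>F t in nhds 0. (\<Phi> has_real_derivative g t) (at t)"
      "(g has_real_derivative L) (at 0)"
    unfolding has_laplacian_def \<Phi>_def by blast
  obtain S where S: "open S" "z \<in> S" "\<And>w. w \<in> S \<Longrightarrow> \<psi> w \<le> \<psi> z"
    using assms(2) unfolding eventually_nhds by blast
  have "\<forall>\<^sub>F t in nhds (0::real). \<Phi> t \<le> \<Phi> 0"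
    using eventually_line_in_open[OF S(1,2), of 1] eventually_line_in_open[OF S(1,2), of \<i>]
    by eventually_elim (use add_mono[OF S(3) S(3)] in \<open>auto simp: \<Phi>_def\<close>)
  with g(1) have "\<forall>\<^sub>F t in nhds (0::real). (\<Phi> has_real_derivative g t) (at t) \<and> \<Phi> t \<le> \<Phi> 0"
    by eventually_elim auto
  then obtain d where d: "d > 0" "\<And>t. dist t 0 < d \<Longrightarrow> (\<Phi> has_real_derivative g t) (at t) \<and> \<Phi> t \<le> \<Phi> 0"
    unfolding eventually_nhds_metric by blast
  have g0: "g 0 = 0"
    by (rule DERIV_local_max[of \<Phi> "g 0" 0 d]) (use d in auto)
  obtain d' where d': "d' > 0" "\<And>h. h > 0 \<Longrightarrow> h < d' \<Longrightarrow> g 0 < g (0 + h)"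
    using DERIV_pos_inc_right[OF g(2) L] by auto
  define t where "t = min d d' / 2"
  have t: "t > 0" "t < d" "t < d'" using d(1) d'(1) by (auto simp: t_def)
  obtain x where x: "0 < x" "x < t" "\<Phi> t - \<Phi> 0 = (t - 0) * g x"
    using MVT2[of 0 t \<Phi> g] t d(2) by auto
  have "g x > 0" using d'(2)[of x] x t g0 by auto
  hence "\<Phi> t > \<Phi> 0" using x t by (smt (verit) mult_pos_pos)
  thus False using d(2)[of t] t by auto
qed

section \<open>A negatively curved metric with two cone points\<close>

text \<open>
  Exponents \<open>A < 1/2\<close> and \<open>B < 2/3\<close> at the cone points make the pullback vanish at double zeros and
  triple 1-points. The factors \<open>1 + \<bar>w\<bar>\<^sup>a\<close> and \<open>1 + \<bar>w - 1\<bar>\<^sup>a\<close> supply the negative curvature, and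
  \<open>a = A + B - 1\<close> balances it at infinity.
\<close>

definition orbifold_density :: "complex \<Rightarrow> real" where
  "orbifold_density w =
     ((1 + norm w powr (1/20)) * (1 + norm (w - 1) powr (1/20))) powr (1/4) /
     (norm w powr (9/20) * norm (w - 1) powr (3/5))"

lemma orbifold_density_nonneg: "orbifold_density w \<ge> 0"
  by (simp add: orbifold_density_def)

text \<open>X is the distance to the nearer cone point and Y the distance to the farther one. The
  left side is the squared density, and the bracket on the right is the Laplacian of ln (1 + X^a) up
  to the factor a^2. After clearing denominators, everything in excess is traded for powers of Y: 3a
  from the factors 1 + Q and 2 - a - 2A from the surplus power of X. Their sum is 2B exactly because
  a = A + B - 1.\<close>

lemma orbifold_density_curvature_aux:
  fixes X Y A B a :: real
  assumes "0 < X" "X \<le> Y" "1/2 \<le> Y" "a = A + B - 1" "0 < a" "a \<le> 1" "a + 2 * A \<le> 2"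
  shows "sqrt ((1 + X powr a) * (1 + Y powr a)) / (X powr (2 * A) * Y powr (2 * B))
           \<le> 27 * (X powr a / (1 + X powr a)\<^sup>2 / X\<^sup>2)"
proof -
  define P Q where "P = X powr a" and "Q = Y powr a"
  have Y: "Y > 0" using assms by auto
  have P: "P > 0" and PQ: "P \<le> Q" using assms Y by (auto simp: P_def Q_def intro: powr_mono2)
  have Q: "1 \<le> 2 * Q"
  proof -
    have "1 \<le> (2 * Y) powr a" using assms by (intro ge_one_powr_ge_zero) auto
    also have "\<dots> = 2 powr a * Q" using Y by (simp add: powr_mult Q_def)
    also have "\<dots> \<le> 2 powr 1 * Q" using assms Y by (intro mult_right_mono powr_mono) (auto simp: Q_def)
    finally show ?thesis by simp
  qed
  have "sqrt ((1 + P) * (1 + Q)) \<le> sqrt ((1 + Q) * (1 + Q))"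
    using P PQ by (intro real_sqrt_le_mono mult_right_mono) auto
  hence sq: "sqrt ((1 + P) * (1 + Q)) \<le> 1 + Q" using P PQ by simp
  have "sqrt ((1 + P) * (1 + Q)) * (1 + P)\<^sup>2 * X\<^sup>2 \<le> (1 + Q) * (1 + Q)\<^sup>2 * X\<^sup>2"
    using sq P PQ by (intro mult_right_mono mult_mono power_mono) auto
  also have "\<dots> = (1 + Q) ^ 3 * X\<^sup>2" by (simp add: power2_eq_square power3_eq_cube)
  \<comment> \<open>Since 1 <= 2Q, 1 + Q <= 3Q; the cube of 3 is the constant 27.\<close>
  also have "\<dots> \<le> (3 * Q) ^ 3 * X\<^sup>2"
    using Q P PQ by (intro mult_right_mono power_mono) auto
  also have "\<dots> = 27 * (Y powr (3 * a) * X\<^sup>2)"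
    using Y by (simp add: Q_def power_mult_distrib powr_power mult.commute)
  also have "Y powr (3 * a) * X\<^sup>2 = Y powr (3 * a) * X powr (2 - a - 2 * A) * X powr (a + 2 * A)"
  proof -
    have "X powr (2 - a - 2 * A) * X powr (a + 2 * A) = X powr 2"
      by (simp only: powr_add[symmetric]) simp
    also have "\<dots> = X\<^sup>2" using assms by simp
    finally show ?thesis by (simp add: mult.assoc)
  qed
  also have "\<dots> \<le> Y powr (3 * a) * Y powr (2 - a - 2 * A) * X powr (a + 2 * A)"
    using assms by (intro mult_left_mono mult_right_mono powr_mono2) auto
  also have "Y powr (3 * a) * Y powr (2 - a - 2 * A) = Y powr (2 * B)"
  proof -
    have "3 * a + (2 - a - 2 * A) = 2 * B" using assms(4) by simp
    thus ?thesis by (metis powr_add)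
  qed
  also have "X powr (a + 2 * A) = P * X powr (2 * A)" by (simp add: P_def powr_add)
  finally have "sqrt ((1 + P) * (1 + Q)) * (1 + P)\<^sup>2 * X\<^sup>2 \<le> 27 * (Y powr (2 * B) * (P * X powr (2 * A)))"
    by simp
  moreover have "X powr (2 * A) > 0" "Y powr (2 * B) > 0" using assms Y by auto
  ultimately show ?thesis
    unfolding P_def[symmetric] Q_def[symmetric]
    using P \<open>0 < X\<close> by (simp add: divide_simps mult_ac)
qed

text \<open>The right side is 27 * 4 * 20^2 = 43200 times the Laplacian of the logarithm of the
  density, so the curvature is at most -1/43200. The two cone points are at distance 1, hence w is
  at least 1/2 away from the farther one, and the summand of the nearer one already
  suffices.\<close>

lemma orbifold_density_curvature:
  assumes "w \<noteq> 0" "w \<noteq> 1"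
  defines "X \<equiv> norm w" and "Y \<equiv> norm (w - 1)"
  shows "(orbifold_density w)\<^sup>2 \<le> 27 * (X powr (1/20) / (1 + X powr (1/20))\<^sup>2 / X\<^sup>2
            + Y powr (1/20) / (1 + Y powr (1/20))\<^sup>2 / Y\<^sup>2)"
proof -
  have pos: "X > 0" "Y > 0" using assms by auto
  have sq: "(orbifold_density w)\<^sup>2 = sqrt ((1 + X powr (1/20)) * (1 + Y powr (1/20))) /
     (X powr (2 * (9/20)) * Y powr (2 * (3/5)))"
  proof -
    have "(((1 + X powr (1/20)) * (1 + Y powr (1/20))) powr (1/4))\<^sup>2 =
        sqrt ((1 + X powr (1/20)) * (1 + Y powr (1/20)))"
      by (subst powr_power) (auto simp: powr_half_sqrt add_nonneg_eq_0_iff)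
    moreover have "(X powr (9/20))\<^sup>2 = X powr (2 * (9/20))" "(Y powr (3/5))\<^sup>2 = Y powr (2 * (3/5))"
      using powr_power[of X "9/20" 2] powr_power[of Y "3/5" 2] pos by auto
    ultimately show ?thesis
      unfolding orbifold_density_def X_def[symmetric] Y_def[symmetric]
      by (simp only: power_divide power_mult_distrib)
  qed
  have XY: "1 \<le> X + Y"
    using norm_triangle_ineq4[of w "w - 1"] unfolding X_def Y_def by simp
  have nn: "X powr (1/20) / (1 + X powr (1/20))\<^sup>2 / X\<^sup>2 \<ge> 0" "Y powr (1/20) / (1 + Y powr (1/20))\<^sup>2 / Y\<^sup>2 \<ge> 0"
    by auto
  show ?thesis
  proof (cases "X \<le> Y")
    case True
    have "(orbifold_density w)\<^sup>2 \<le> 27 * (X powr (1/20) / (1 + X powr (1/20))\<^sup>2 / X\<^sup>2)"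
      unfolding sq by (rule orbifold_density_curvature_aux) (use True XY pos in auto)
    thus ?thesis by (rule order_trans) (use nn in simp)
  next
    case False
    have "sqrt ((1 + Y powr (1/20)) * (1 + X powr (1/20))) / (Y powr (2 * (3/5)) * X powr (2 * (9/20)))
        \<le> 27 * (Y powr (1/20) / (1 + Y powr (1/20))\<^sup>2 / Y\<^sup>2)"
      by (rule orbifold_density_curvature_aux) (use False XY pos in auto)
    hence "(orbifold_density w)\<^sup>2 \<le> 27 * (Y powr (1/20) / (1 + Y powr (1/20))\<^sup>2 / Y\<^sup>2)"
      unfolding sq by (simp add: mult_ac)
    thus ?thesis by (rule order_trans) (use nn in simp)
  qed
qed

text \<open>Comparison with the spherical density: the denominator grows with exponent 21/20 only,
  below the exponent 2 of the sphere. The points 0 and 1 must be excluded, because division by zero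
  gives the density the value 0 there.\<close>

lemma orbifold_density_ge:
  assumes "w \<noteq> 0" "w \<noteq> 1"
  shows "1 / (1 + (norm w)\<^sup>2) \<le> 2 * orbifold_density w"
proof -
  define X Y where "X = norm w" and "Y = norm (w - 1)"
  have pos: "X > 0" "Y > 0" using assms by (auto simp: X_def Y_def)
  have YX: "Y \<le> 1 + X" using norm_triangle_ineq4[of w 1] unfolding X_def Y_def by simp
  have "X powr (9/20) * Y powr (3/5) \<le> (1 + X) powr (9/20) * (1 + X) powr (3/5)"
    using pos YX by (intro mult_mono powr_mono2) auto
  also have "\<dots> = (1 + X) powr (21/20)" by (simp add: powr_add[symmetric])
  also have "\<dots> \<le> (1 + X) powr 2" using pos by (intro powr_mono) auto
  also have "\<dots> = (1 + X)\<^sup>2" using pos by simp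
  also have "\<dots> \<le> 2 * (1 + X\<^sup>2)"
    using sum_squares_bound[of 1 X] by (simp add: power2_eq_square algebra_simps)
  finally have *: "X powr (9/20) * Y powr (3/5) \<le> 2 * (1 + X\<^sup>2)" .
  have "1 / (2 * (1 + X\<^sup>2)) \<le> 1 / (X powr (9/20) * Y powr (3/5))"
    using * pos by (intro divide_left_mono) (auto intro!: mult_pos_pos add_pos_nonneg)
  also have "\<dots> \<le> ((1 + X powr (1/20)) * (1 + Y powr (1/20))) powr (1/4) / (X powr (9/20) * Y powr (3/5))"
    using pos mult_mono[of 1 "1 + X powr (1/20)" 1 "1 + Y powr (1/20)"]
    by (intro divide_right_mono ge_one_powr_ge_zero) auto
  also have "\<dots> = orbifold_density w" by (simp add: orbifold_density_def X_def Y_def)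
  finally have "2 * (1 / (2 * (1 + X\<^sup>2))) \<le> 2 * orbifold_density w" by linarith
  moreover have "2 * (1 / (2 * t)) = 1 / t" for t :: real by simp
  ultimately have "1 / (1 + X\<^sup>2) \<le> 2 * orbifold_density w" by metis
  thus ?thesis unfolding X_def by simp
qed

section \<open>Behaviour of the pullback at multiple points\<close>

text \<open>At a zero of order m >= n the quotient behaves like |w - z| to the power m(1 - \<gamma>)
  - 1, which is positive. The condition \<open>real n * (1 - \<gamma>) > 1\<close> reads 11/10 > 1
  for n = 2, \<gamma> = 9/20 and 6/5 > 1 for n = 3, \<gamma> = 3/5. Stating the order as an upper
  bound admits functions that vanish identically near z.\<close>

lemma deriv_div_powr_tendsto_0:
  assumes k: "k holomorphic_on S" "open S" "z \<in> S" and kz: "k z = 0"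
    and ord: "\<forall>\<^sub>F w in at z. norm (k w) \<le> C * norm (w - z) ^ n"
    and \<gamma>: "\<gamma> < 1" "real n * (1 - \<gamma>) > 1"
  shows "((\<lambda>w. norm (deriv k w) / norm (k w) powr \<gamma>) \<longlongrightarrow> 0) (at z)"
proof -
  obtain e where e: "e > 0" "ball z e \<subseteq> S" using k by (meson openE)
  have kb: "k holomorphic_on ball z e" using k(1) e(2) by (rule holomorphic_on_subset)
  have evb: "\<forall>\<^sub>F w in at z. w \<in> ball z e"
    using e(1) by (intro eventually_at_in_open') auto
  show ?thesis
  proof (cases "\<exists>w\<in>ball z e. k w \<noteq> 0")
    case False
    have "\<forall>\<^sub>F w in at z. norm (deriv k w) / norm (k w) powr \<gamma> = 0"
      using evb
    proof eventually_elim
      case (elim w)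
      have "\<forall>\<^sub>F u in nhds w. k u = 0"
        using elim False by (intro eventually_nhds_in_open[THEN eventually_mono, of "ball z e"]) auto
      hence "deriv k w = deriv (\<lambda>_. 0) w" by (intro deriv_cong_ev) auto
      thus ?case by simp
    qed
    thus ?thesis by (rule tendsto_eventually)
  next
    case True
    define m where "m = nat (zorder k z)"
    define g where "g = zor_poly k z"
    have "z \<in> ball z e" using e(1) by simp
    from zorder_exist_zero[OF kb open_ball connected_ball this True] kz
    obtain d where d: "d > 0" "cball z d \<subseteq> ball z e" "g holomorphic_on cball z d"
        "\<And>w. w \<in> cball z d \<Longrightarrow> k w = g w * (w - z) ^ m \<and> g w \<noteq> 0" and m0: "m > 0"
      unfolding m_def g_def by auto
    have gh: "g holomorphic_on ball z d" using d(3) ball_subset_cball by (rule holomorphic_on_subset)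
    have evd: "\<forall>\<^sub>F w in at z. w \<in> ball z d - {z}"
      using d(1) by (intro eventually_at_in_open) auto
    have gcont: "(g \<longlongrightarrow> g z) (at z)"
      using gh d(1) by (metis centre_in_ball holomorphic_on_imp_continuous_on continuous_on_eq_continuous_at isContD open_ball)
    have dgcont: "(deriv g \<longlongrightarrow> deriv g z) (at z)"
      using holomorphic_deriv[OF gh open_ball] d(1)
      by (metis centre_in_ball holomorphic_on_imp_continuous_on continuous_on_eq_continuous_at isContD open_ball)
    have gz: "g z \<noteq> 0" using d by auto
    \<comment> \<open>If the order m were smaller than n, dividing the bound by |w - z|^m would
      force the cofactor g to vanish at z.\<close>
    have mn: "n \<le> m"
    proof (rule ccontr)
      assume "\<not> n \<le> m"
      hence mn: "m < n" by simp
      have ev: "\<forall>\<^sub>F w in at z. norm (g w) \<le> C * norm (w - z) ^ (n - m)"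
        using ord evd
      proof eventually_elim
        case (elim w)
        hence "norm (g w) * norm (w - z) ^ m \<le> C * norm (w - z) ^ (n - m) * norm (w - z) ^ m"
          using d(4)[of w] mn by (auto simp: norm_mult norm_power mult.assoc power_add[symmetric])
        thus ?case using elim by simp
      qed
      have "((\<lambda>w. C * norm (w - z) ^ (n - m)) \<longlongrightarrow> C * norm (z - z) ^ (n - m)) (at z)"
        by (intro tendsto_intros)
      hence "((\<lambda>w. C * norm (w - z) ^ (n - m)) \<longlongrightarrow> 0) (at z)" using mn by (simp add: power_0_left)
      from tendsto_le[OF at_neq_bot this tendsto_norm[OF gcont] ev]
      have "norm (g z) \<le> 0" .
      thus False using gz by simp
    qed
    \<comment> \<open>The cofactor in \<open>deriv k w = (w - z) ^ (m - 1) * q w\<close>; it has a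
      finite limit at z.\<close>
    define q where "q w = deriv g w * (w - z) + of_nat m * g w" for w
    have qlim: "(q \<longlongrightarrow> deriv g z * (z - z) + of_nat m * g z) (at z)"
      unfolding q_def by (intro tendsto_intros gcont dgcont)
    define \<delta> where "\<delta> = real m * (1 - \<gamma>) - 1"
    have \<delta>: "\<delta> > 0"
    proof -
      have "real n * (1 - \<gamma>) \<le> real m * (1 - \<gamma>)" using mn \<gamma> by (intro mult_right_mono) auto
      thus ?thesis using \<gamma> unfolding \<delta>_def by linarith
    qed
    have "\<forall>\<^sub>F w in at z. norm (w - z) powr \<delta> * norm (q w) / norm (g w) powr \<gamma> =
        norm (deriv k w) / norm (k w) powr \<gamma>"
      using evd
    proof eventually_elim
      case (elim w)
      hence w: "w \<in> ball z d" "w \<noteq> z" by auto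
      have gd: "(g has_field_derivative deriv g w) (at w)"
        using gh w by (intro holomorphic_derivI) auto
      have "((\<lambda>w. g w * (w - z) ^ m) has_field_derivative
          deriv g w * (w - z) ^ m + of_nat m * (w - z) ^ (m - 1) * g w) (at w)"
        using gd by (auto intro!: derivative_eq_intros)
      hence "(k has_field_derivative deriv g w * (w - z) ^ m + of_nat m * (w - z) ^ (m - 1) * g w) (at w)"
        by (rule has_field_derivative_transform_within_open[of _ _ _ "ball z d"]) (use w d(4) in auto)
      hence "deriv k w = deriv g w * (w - z) ^ m + of_nat m * (w - z) ^ (m - 1) * g w"
        by (rule DERIV_imp_deriv)
      also have "(w - z) ^ m = (w - z) * (w - z) ^ (m - 1)" using m0 by (metis power_eq_if not_gr_zero)
      finally have dk: "deriv k w = (w - z) ^ (m - 1) * q w" by (simp add: q_def algebra_simps)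
      define t where "t = norm (w - z)"
      have t: "t > 0" using w by (simp add: t_def)
      have "norm (deriv k w) / norm (k w) powr \<gamma> = t ^ (m - 1) * norm (q w) / (norm (g w) * t ^ m) powr \<gamma>"
        using d(4)[of w] w by (simp add: dk norm_mult norm_power t_def)
      also have "\<dots> = t powr real (m - 1) * norm (q w) / (norm (g w) powr \<gamma> * t powr (real m * \<gamma>))"
        using t by (simp add: powr_mult powr_realpow[symmetric] powr_powr)
      also have "\<dots> = (t powr real (m - 1) / t powr (real m * \<gamma>)) * norm (q w) / norm (g w) powr \<gamma>"
        by simp
      also have "t powr real (m - 1) / t powr (real m * \<gamma>) = t powr \<delta>"
        using m0 by (simp add: powr_diff[symmetric] \<delta>_def of_nat_diff algebra_simps)
      finally show ?case by (simp add: t_def)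
    qed
    moreover have "((\<lambda>w. norm (w - z) powr \<delta> * norm (q w) / norm (g w) powr \<gamma>) \<longlongrightarrow>
        norm (z - z) powr \<delta> * norm (deriv g z * (z - z) + of_nat m * g z) / norm (g z) powr \<gamma>) (at z)"
      using \<delta> gz by (intro tendsto_intros tendsto_powr' qlim gcont) auto
    ultimately show ?thesis using \<delta> by (simp add: filterlim_cong[OF refl refl])
  qed
qed

section \<open>The Ahlfors-Schwarz lemma\<close>

lemma holomorphic_on_imp_isCont:
  assumes "k holomorphic_on S" "open S" "z \<in> S"
  shows "isCont k z"
  using holomorphic_on_imp_continuous_on[OF assms(1)] assms(2,3) by (simp add: continuous_on_eq_continuous_at)

text \<open>At the cone points \<open>orbifold_density\<close> is 0 by division by zero, so the
  product is 0 at the 0-points and 1-points of k. The multiplicities make its limit 0 as well, so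
  the conventional value is the continuous one.\<close>

lemma isCont_deriv_mult_orbifold_density:
  assumes k: "k holomorphic_on S" "open S" "z \<in> S"
    and ord0: "k z = 0 \<Longrightarrow> \<exists>C. \<forall>\<^sub>F w in at z. norm (k w) \<le> C * norm (w - z) ^ 2"
    and ord1: "k z = 1 \<Longrightarrow> \<exists>C. \<forall>\<^sub>F w in at z. norm (k w - 1) \<le> C * norm (w - z) ^ 3"
  shows "isCont (\<lambda>w. norm (deriv k w) * orbifold_density (k w)) z"
proof -
  have kc: "(k \<longlongrightarrow> k z) (at z)"
    using holomorphic_on_imp_isCont[OF k] by (rule isContD)
  have dc: "(deriv k \<longlongrightarrow> deriv k z) (at z)"
    using holomorphic_on_imp_isCont[OF holomorphic_deriv[OF k(1,2)] k(2,3)] by (rule isContD)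
  have p: "((\<lambda>w. norm (k w - b) powr (1/20)) \<longlongrightarrow> norm (k z - b) powr (1/20)) (at z)" for b
    by (intro tendsto_powr' tendsto_intros kc) auto
  have ne: "1 + norm (k z - b) powr (1/20) \<noteq> 0" for b
    using powr_ge_zero[of "norm (k z - b)" "1/20"] by linarith
  have num: "((\<lambda>w. ((1 + norm (k w) powr (1/20)) * (1 + norm (k w - 1) powr (1/20))) powr (1/4)) \<longlongrightarrow>
      ((1 + norm (k z) powr (1/20)) * (1 + norm (k z - 1) powr (1/20))) powr (1/4)) (at z)"
    by (rule tendsto_powr[OF tendsto_mult[OF tendsto_add[OF tendsto_const p[of 0, simplified]]
        tendsto_add[OF tendsto_const p[of 1]]] tendsto_const]) (use ne[of 0] ne[of 1] in simp)
  have q: "((\<lambda>w. norm (k w - b) powr \<gamma>) \<longlongrightarrow> norm (k z - b) powr \<gamma>) (at z)" if "k z \<noteq> b" for b \<gamma>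
    using that by (intro tendsto_powr tendsto_norm tendsto_diff kc tendsto_const) auto
  consider "k z = 0" | "k z = 1" | "k z \<noteq> 0" "k z \<noteq> 1" by blast
  thus ?thesis
  proof cases
    case 1
    obtain C where C: "\<forall>\<^sub>F w in at z. norm (k w) \<le> C * norm (w - z) ^ 2" using ord0[OF 1] by blast
    have "((\<lambda>w. norm (deriv k w) / norm (k w) powr (9/20)) \<longlongrightarrow> 0) (at z)"
      by (rule deriv_div_powr_tendsto_0[OF k 1 C]) auto
    hence "((\<lambda>w. (norm (deriv k w) / norm (k w) powr (9/20)) *
      (((1 + norm (k w) powr (1/20)) * (1 + norm (k w - 1) powr (1/20))) powr (1/4)
        / norm (k w - 1) powr (3/5))) \<longlongrightarrow>
       0 * (((1 + norm (k z) powr (1/20)) * (1 + norm (k z - 1) powr (1/20))) powr (1/4)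
        / norm (k z - 1) powr (3/5))) (at z)"
      by (rule tendsto_mult[OF _ tendsto_divide[OF num q]]) (use 1 in simp_all)
    thus ?thesis using 1 by (simp add: isCont_def orbifold_density_def)
  next
    case 2
    obtain C where C: "\<forall>\<^sub>F w in at z. norm (k w - 1) \<le> C * norm (w - z) ^ 3" using ord1[OF 2] by blast
    have "((\<lambda>w. norm (deriv (\<lambda>w. k w - 1) w) / norm (k w - 1) powr (3/5)) \<longlongrightarrow> 0) (at z)"
      by (rule deriv_div_powr_tendsto_0[OF _ k(2,3) _ C])
         (use 2 k in \<open>auto intro!: holomorphic_intros\<close>)
    moreover have "\<forall>\<^sub>F w in at z. deriv (\<lambda>w. k w - 1) w = deriv k w"
      using eventually_at_in_open'[OF k(2,3)]
    proof eventually_elim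
      case (elim w)
      have "k field_differentiable at w" using k elim holomorphic_on_imp_differentiable_at by blast
      thus ?case by simp
    qed
    hence "\<forall>\<^sub>F w in at z. norm (deriv (\<lambda>w. k w - 1) w) / norm (k w - 1) powr (3/5) =
        norm (deriv k w) / norm (k w - 1) powr (3/5)"
      by eventually_elim simp
    note tendsto_cong[OF this]
    ultimately have "((\<lambda>w. norm (deriv k w) / norm (k w - 1) powr (3/5)) \<longlongrightarrow> 0) (at z)"
      by simp
    hence "((\<lambda>w. (norm (deriv k w) / norm (k w - 1) powr (3/5)) *
      (((1 + norm (k w) powr (1/20)) * (1 + norm (k w - 1) powr (1/20))) powr (1/4)
        / norm (k w) powr (9/20))) \<longlongrightarrow>
       0 * (((1 + norm (k z) powr (1/20)) * (1 + norm (k z - 1) powr (1/20))) powr (1/4)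
        / norm (k z) powr (9/20))) (at z)"
      by (rule tendsto_mult[OF _ tendsto_divide[OF num q[of 0, simplified]]]) (use 2 in simp_all)
    thus ?thesis using 2 by (simp add: isCont_def orbifold_density_def mult.commute)
  next
    case 3
    show ?thesis unfolding isCont_def orbifold_density_def
      by (rule tendsto_mult[OF tendsto_norm[OF dc] tendsto_divide[OF num tendsto_mult[OF q[of 0, simplified] q]]])
         (use 3 in simp_all)
  qed
qed

text \<open>F is a logarithm of k, so F' = k'/k. Used for k, k - 1 and k', it turns the logarithm of
  the pulled back density into an expression in real parts of holomorphic functions.\<close>

lemma holomorphic_log_on_ball:
  assumes "k holomorphic_on ball z e" "\<And>w. w \<in> ball z e \<Longrightarrow> k w \<noteq> 0"
  obtains F where "F holomorphic_on ball z e"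
    "\<And>w. w \<in> ball z e \<Longrightarrow> norm (k w) = exp (Re (F w))"
    "\<And>w. w \<in> ball z e \<Longrightarrow> norm (deriv F w) = norm (deriv k w) / norm (k w)"
proof -
  obtain F where F: "F holomorphic_on ball z e" "\<And>w. w \<in> ball z e \<Longrightarrow> k w = exp (F w)"
    using contractible_imp_holomorphic_log[OF assms(1) convex_imp_contractible[OF convex_ball] assms(2)] by blast
  have "norm (deriv F w) = norm (deriv k w) / norm (k w)" if w: "w \<in> ball z e" for w
  proof -
    have "(F has_field_derivative deriv F w) (at w)"
      using F(1) w by (intro holomorphic_derivI) auto
    hence "((\<lambda>w. exp (F w)) has_field_derivative exp (F w) * deriv F w) (at w)"
      by (auto intro!: derivative_eq_intros)
    hence "(k has_field_derivative exp (F w) * deriv F w) (at w)"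
      by (rule has_field_derivative_transform_within_open[of _ _ _ "ball z e"]) (use w F(2) in auto)
    hence "deriv k w = k w * deriv F w" using F(2)[OF w] by (simp add: DERIV_imp_deriv)
    thus ?thesis using assms(2)[OF w] by (simp add: norm_mult)
  qed
  moreover have "norm (k w) = exp (Re (F w))" if "w \<in> ball z e" for w
    using F(2)[OF that] by (simp add: norm_exp_eq_Re)
  ultimately show ?thesis using F(1) that by blast
qed

text \<open>At x = ln |k| the function is ln (1 + |k|^a). Its strict convexity is the source of the
  negative curvature; the pure powers in the density contribute only harmonic terms.\<close>

lemma softplus_derivatives:
  fixes a :: real
  shows "((\<lambda>x. ln (1 + exp (a * x))) has_real_derivative a * exp (a * x) / (1 + exp (a * x))) (at x)"
    and "((\<lambda>x. a * exp (a * x) / (1 + exp (a * x))) has_real_derivative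
            a\<^sup>2 * (exp (a * x) / (1 + exp (a * x))\<^sup>2)) (at x)"
proof -
  have pos: "1 + exp (a * x) > 0" by (simp add: add_pos_pos)
  show "((\<lambda>x. ln (1 + exp (a * x))) has_real_derivative a * exp (a * x) / (1 + exp (a * x))) (at x)"
    using pos by (auto intro!: derivative_eq_intros)
  show "((\<lambda>x. a * exp (a * x) / (1 + exp (a * x))) has_real_derivative
            a\<^sup>2 * (exp (a * x) / (1 + exp (a * x))\<^sup>2)) (at x)"
    using pos by (auto intro!: derivative_eq_intros simp: divide_simps power2_eq_square) (simp add: algebra_simps)
qed

text \<open>v is 2r times the quotient of the pulled back density by the Poincare density of the
  disc. At a maximum the Laplacian of ln v is at most 0, so the positive contribution of the cone
  metric is bounded by that of the disc, and the curvature estimate turns this into a bound for v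
  itself.\<close>

lemma orbifold_schwarz_lemma_at_local_max:
  fixes k :: "complex \<Rightarrow> complex"
  defines "v \<equiv> \<lambda>c r w. norm (deriv k w) * orbifold_density (k w) * (r\<^sup>2 - (norm (w - c))\<^sup>2)"
  assumes hol: "k holomorphic_on ball z e" and e: "e > 0" "ball z e \<subseteq> ball c r"
    and nz: "\<And>w. w \<in> ball z e \<Longrightarrow> k w \<noteq> 0 \<and> k w \<noteq> 1 \<and> deriv k w \<noteq> 0"
    and max: "\<And>w. w \<in> ball z e \<Longrightarrow> v c r w \<le> v c r z"
  shows "v c r z \<le> 500 * r"
proof -
  have zb: "z \<in> ball z e" using e by simp
  have r: "r > 0" using zb e(2) by (metis ball_eq_empty empty_iff linorder_not_le subsetD)
  obtain F where F: "F holomorphic_on ball z e" "\<And>w. w \<in> ball z e \<Longrightarrow> norm (k w) = exp (Re (F w))"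
      "\<And>w. w \<in> ball z e \<Longrightarrow> norm (deriv F w) = norm (deriv k w) / norm (k w)"
    by (rule holomorphic_log_on_ball[OF hol]) (use nz in auto)
  have hol1: "(\<lambda>w. k w - 1) holomorphic_on ball z e" using hol by (intro holomorphic_intros)
  obtain G where G: "G holomorphic_on ball z e" "\<And>w. w \<in> ball z e \<Longrightarrow> norm (k w - 1) = exp (Re (G w))"
      "\<And>w. w \<in> ball z e \<Longrightarrow> norm (deriv G w) = norm (deriv (\<lambda>w. k w - 1) w) / norm (k w - 1)"
    by (rule holomorphic_log_on_ball[OF hol1]) (use nz in auto)
  have G3: "norm (deriv G w) = norm (deriv k w) / norm (k w - 1)" if "w \<in> ball z e" for w
  proof -
    have "k field_differentiable at w"
      using hol that holomorphic_on_imp_differentiable_at open_ball by blast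
    thus ?thesis using G(3)[OF that] by simp
  qed
  obtain H where H: "H holomorphic_on ball z e" "\<And>w. w \<in> ball z e \<Longrightarrow> norm (deriv k w) = exp (Re (H w))"
    by (rule holomorphic_log_on_ball[OF holomorphic_deriv[OF hol open_ball]]) (use nz in auto)
  define s :: "real \<Rightarrow> real" where "s x = ln (1 + exp (1/20 * x))" for x
  define s2 :: "real \<Rightarrow> real" where "s2 x = (1/20)\<^sup>2 * (exp (1/20 * x) / (1 + exp (1/20 * x))\<^sup>2)" for x
  have s: "(s has_real_derivative 1/20 * exp (1/20 * x) / (1 + exp (1/20 * x))) (at x)"
    "((\<lambda>x. 1/20 * exp (1/20 * x) / (1 + exp (1/20 * x))) has_real_derivative s2 x) (at x)" for x
    unfolding s_def[abs_def] s2_def by (rule softplus_derivatives)+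
  define D where "D w = r\<^sup>2 - (norm (w - c))\<^sup>2" for w
  have Dpos: "D w > 0" if "w \<in> ball z e" for w
  proof -
    have "norm (w - c) < r" using subsetD[OF e(2) that] by (simp add: dist_norm norm_minus_commute)
    from power_strict_mono[OF this, of 2] show ?thesis by (simp add: D_def)
  qed
  \<comment> \<open>This is the logarithm of \<open>v c r w\<close>, split into terms of known
    Laplacian: three harmonic ones, two softplus terms and the disc term.\<close>
  define \<psi> where "\<psi> w = Re (H w) + ((-9/20) * Re (F w) + ((-3/5) * Re (G w) +
      (1/4 * s (Re (F w)) + (1/4 * s (Re (G w)) + ln (D w)))))" for w
  have \<psi>: "v c r w = exp (\<psi> w)" if w: "w \<in> ball z e" for w
  proof -
    have pw: "exp x powr a = exp (a * x)" for x a :: real by (simp add: powr_def)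
    have ne: "1 + exp x \<noteq> 0" for x :: real by (smt (verit) exp_gt_zero)
    have "ln ((1 + exp (1/20 * Re (F w))) * (1 + exp (1/20 * Re (G w)))) = s (Re (F w)) + s (Re (G w))"
      by (simp only: s_def ln_mult ne simp_thms if_True)
    hence "((1 + exp (1/20 * Re (F w))) * (1 + exp (1/20 * Re (G w)))) powr (1/4)
        = exp (1/4 * (s (Re (F w)) + s (Re (G w))))"
      by (simp only: powr_def mult_eq_0_iff ne simp_thms if_False)
    hence "orbifold_density (k w) = exp (1/4 * (s (Re (F w)) + s (Re (G w)))) /
        (exp (9/20 * Re (F w)) * exp (3/5 * Re (G w)))"
      unfolding orbifold_density_def F(2)[OF w] G(2)[OF w] pw by simp
    also have "\<dots> = exp (1/4 * (s (Re (F w)) + s (Re (G w))) - (9/20 * Re (F w) + 3/5 * Re (G w)))"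
      by (simp only: exp_diff exp_add)
    finally have "v c r w = exp (Re (H w)) *
        exp (1/4 * (s (Re (F w)) + s (Re (G w))) - (9/20 * Re (F w) + 3/5 * Re (G w))) * exp (ln (D w))"
      unfolding v_def H(2)[OF w] using Dpos[OF w] by (simp add: D_def)
    also have "\<dots> = exp (\<psi> w)"
      unfolding \<psi>_def by (simp only: exp_add[symmetric]) (simp add: algebra_simps)
    finally show ?thesis .
  qed
  have id: "has_laplacian (\<lambda>w. Re (K w)) 0 z" if "K holomorphic_on ball z e" for K
    using has_laplacian_compose_Re[OF that open_ball zb, of "\<lambda>x. x" "\<lambda>_. 1" "\<lambda>_. 0"] by simp
  have lap: "has_laplacian \<psi> (0 + ((-9/20) * 0 + ((-3/5) * 0 +
      (1/4 * (s2 (Re (F z)) * (norm (deriv F z))\<^sup>2) + (1/4 * (s2 (Re (G z)) * (norm (deriv G z))\<^sup>2) +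
       - (4 * r\<^sup>2 / (D z)\<^sup>2)))))) z"
    unfolding \<psi>_def D_def
    by (intro has_laplacian_add has_laplacian_cmult id H(1) F(1) G(1) has_laplacian_ln_disc
        has_laplacian_compose_Re[OF F(1) open_ball zb s] has_laplacian_compose_Re[OF G(1) open_ball zb s])
       (use subsetD[OF e(2) zb] in \<open>simp add: dist_norm norm_minus_commute\<close>)
  have "\<forall>\<^sub>F w in nhds z. \<psi> w \<le> \<psi> z"
    using eventually_nhds_in_open[OF open_ball zb]
  proof eventually_elim
    case (elim w)
    thus ?case using max[OF elim] \<psi>[OF elim] \<psi>[OF zb] by simp
  qed
  from has_laplacian_local_max[OF lap this]
  have le: "s2 (Re (F z)) * (norm (deriv F z))\<^sup>2 + s2 (Re (G z)) * (norm (deriv G z))\<^sup>2 \<le> 16 * r\<^sup>2 / (D z)\<^sup>2"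
    by simp
  define u where "u = norm (deriv k z) * orbifold_density (k z)"
  define X Y where "X = norm (k z)" and "Y = norm (k z - 1)"
  have X: "exp (1/20 * Re (F z)) = X powr (1/20)" and Y: "exp (1/20 * Re (G z)) = Y powr (1/20)"
    using F(2)[OF zb] G(2)[OF zb] by (simp_all add: X_def Y_def powr_def)
  have "u\<^sup>2 \<le> (norm (deriv k z))\<^sup>2 * (27 * (X powr (1/20) / (1 + X powr (1/20))\<^sup>2 / X\<^sup>2
            + Y powr (1/20) / (1 + Y powr (1/20))\<^sup>2 / Y\<^sup>2))"
    unfolding u_def power_mult_distrib X_def Y_def
    using nz[OF zb] by (intro mult_left_mono orbifold_density_curvature) auto
  \<comment> \<open>10800 = 27 * 20^2, because \<open>s2\<close> carries the factor
    (1/20)^2.\<close>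
  also have "\<dots> = 10800 * (s2 (Re (F z)) * (norm (deriv F z))\<^sup>2 + s2 (Re (G z)) * (norm (deriv G z))\<^sup>2)"
    unfolding s2_def F(3)[OF zb] G3[OF zb] X Y X_def[symmetric] Y_def[symmetric]
    by (simp add: power_divide algebra_simps)
  \<comment> \<open>172800 = 10800 * 16, and its square root is below 500.\<close>
  also have "\<dots> \<le> 172800 * (r\<^sup>2 / (D z)\<^sup>2)" using le by simp
  finally have "(u * D z)\<^sup>2 \<le> 172800 * r\<^sup>2"
    using Dpos[OF zb] by (simp add: field_simps power_mult_distrib)
  also have "\<dots> \<le> (500 * r)\<^sup>2" by (simp add: power_mult_distrib)
  finally have "u * D z \<le> 500 * r" by (rule power2_le_imp_le) (use r in simp)
  thus ?thesis by (simp add: v_def u_def D_def)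
qed

text \<open>The weight r^2 - |w - c|^2 vanishes on the boundary circle, so a positive maximum over
  the closed disc is interior. There k' and the density are nonzero, hence k avoids 0 and 1 and k'
  avoids 0 on a whole neighbourhood, as the local statement requires.\<close>

lemma orbifold_schwarz_lemma:
  assumes k: "k holomorphic_on S" "open S" "cball c r \<subseteq> S" "r > 0"
    and ord0: "\<And>z. z \<in> S \<Longrightarrow> k z = 0 \<Longrightarrow> \<exists>C. \<forall>\<^sub>F w in at z. norm (k w) \<le> C * norm (w - z) ^ 2"
    and ord1: "\<And>z. z \<in> S \<Longrightarrow> k z = 1 \<Longrightarrow> \<exists>C. \<forall>\<^sub>F w in at z. norm (k w - 1) \<le> C * norm (w - z) ^ 3"
    and z: "z \<in> cball c r"
  shows "norm (deriv k z) * orbifold_density (k z) * (r\<^sup>2 - (norm (z - c))\<^sup>2) \<le> 500 * r"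
proof -
  define v where "v w = norm (deriv k w) * orbifold_density (k w) * (r\<^sup>2 - (norm (w - c))\<^sup>2)" for w
  have "isCont v w" if "w \<in> S" for w
  proof -
    have "isCont (\<lambda>w. r\<^sup>2 - (norm (w - c))\<^sup>2) w" by (intro continuous_intros)
    from isCont_mult[OF isCont_deriv_mult_orbifold_density[OF k(1,2) that ord0[OF that] ord1[OF that]] this]
    show ?thesis unfolding v_def .
  qed
  hence "continuous_on (cball c r) v"
    using k(3) by (intro continuous_at_imp_continuous_on) auto
  then obtain y where y: "y \<in> cball c r" "\<And>w. w \<in> cball c r \<Longrightarrow> v w \<le> v y"
    using continuous_attains_sup[OF compact_cball, of c r v] z by blast
  have "v y \<le> 500 * r"
  proof (cases "v y \<le> 0")
    case True
    thus ?thesis using k(4) by linarith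
  next
    case False
    hence fac: "deriv k y \<noteq> 0" "orbifold_density (k y) \<noteq> 0" "r\<^sup>2 \<noteq> (norm (y - c))\<^sup>2"
      by (auto simp: v_def)
    \<comment> \<open>The default value 0 of the density at the cone points is what excludes them
      here.\<close>
    from fac(2) have ky: "k y \<noteq> 0" "k y \<noteq> 1" by (auto simp: orbifold_density_def)
    have yb: "y \<in> ball c r" using y(1) fac(3) by (auto simp: dist_norm norm_minus_commute less_le)
    have "ball c r \<subseteq> S" using ball_subset_cball k(3) by (rule subset_trans)
    hence kc: "continuous_on (ball c r) k" "continuous_on (ball c r) (deriv k)"
      using holomorphic_on_imp_continuous_on[OF k(1)]
        holomorphic_on_imp_continuous_on[OF holomorphic_deriv[OF k(1,2)]]
      by (auto intro: continuous_on_subset)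
    define W where "W = ball c r \<inter> (k -` (- {0, 1})) \<inter> (ball c r \<inter> deriv k -` (- {0}))"
    have "open W"
      unfolding W_def
      by (intro open_Int continuous_open_preimage[OF kc(1) open_ball] continuous_open_preimage[OF kc(2) open_ball])
         (simp_all add: open_Compl finite_imp_closed)
    moreover have "y \<in> W" using yb ky fac by (auto simp: W_def)
    ultimately obtain e where e: "e > 0" "ball y e \<subseteq> W" by (meson openE)
    have "ball y e \<subseteq> S" using e(2) \<open>ball c r \<subseteq> S\<close> by (auto simp: W_def)
    hence hol: "k holomorphic_on ball y e" using k(1) holomorphic_on_subset by blast
    show ?thesis
      unfolding v_def
      by (rule orbifold_schwarz_lemma_at_local_max[OF hol e(1)])
         (use e(2) y(2) in \<open>auto simp: W_def v_def subset_iff\<close>)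
  qed
  thus ?thesis using y(2)[OF z] unfolding v_def by linarith
qed

section \<open>Moebius transformations and the chordal metric\<close>

lemma sqrt_one_plus_square_le: "sqrt (1 + (norm z)\<^sup>2) \<le> 1 + norm z"
  by (rule real_le_lsqrt) (auto simp: power2_eq_square algebra_simps)

lemma dist_Finite_le: "dist (Finite z) (Finite w) \<le> 2 * norm (z - w)"
proof -
  have "1 * 1 \<le> sqrt (1 + (norm z)\<^sup>2) * sqrt (1 + (norm w)\<^sup>2)"
    by (intro mult_mono) auto
  hence "2 * norm (z - w) / (sqrt (1 + (norm z)\<^sup>2) * sqrt (1 + (norm w)\<^sup>2)) \<le> 2 * norm (z - w) / 1"
    by (intro divide_left_mono) auto
  thus ?thesis by (simp add: dist_Finite_Finite)
qed

lemma norm_diff_le_dist_Finite: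
  "norm (z - w) \<le> (1 + norm z) * (1 + norm w) * dist (Finite z) (Finite w)"
proof -
  define s where "s = sqrt (1 + (norm z)\<^sup>2) * sqrt (1 + (norm w)\<^sup>2)"
  have s: "s > 0" unfolding s_def by (intro mult_pos_pos) (auto simp: add_pos_nonneg)
  have "norm (z - w) \<le> s * dist (Finite z) (Finite w)"
    using s by (simp add: dist_Finite_Finite s_def[symmetric])
  also have "\<dots> \<le> (1 + norm z) * (1 + norm w) * dist (Finite z) (Finite w)"
    unfolding s_def by (intro mult_right_mono mult_mono sqrt_one_plus_square_le) auto
  finally show ?thesis .
qed

lemma dist_Finite_Infty_le:
  assumes "z \<noteq> 0"
  shows "dist (Finite z) Infty \<le> 2 / norm z"
proof -
  have "norm z \<le> sqrt (1 + (norm z)\<^sup>2)" by (rule real_le_rsqrt) simp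
  thus ?thesis unfolding dist_Finite_Infty using assms
    by (intro divide_left_mono mult_pos_pos) (auto simp: add_pos_nonneg)
qed

text \<open>The point [x : y] of the projective line. Homogeneous coordinates make infinity an
  ordinary point and Moebius maps linear. Since \<open>homog 0 0\<close> is also
  \<open>Infty\<close>, the vectors have to be assumed nonzero below.\<close>

definition homog :: "complex \<Rightarrow> complex \<Rightarrow> ext_complex" where
  "homog x y = (if y = 0 then Infty else Finite (x / y))"

lemma ext_complex_eq_homog:
  obtains x y where "a = homog x y" "(x, y) \<noteq> 0"
proof (cases a)
  case (Finite z)
  thus ?thesis using that[of z 1] by (simp add: homog_def zero_prod_def)
next
  case Infty
  thus ?thesis using that[of 1 0] by (simp add: homog_def zero_prod_def)
qed

lemma homog_mult: "c \<noteq> 0 \<Longrightarrow> homog (c * x) (c * y) = homog x y"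
  by (simp add: homog_def)

text \<open>The chordal distance is twice the sine of the angle between two complex lines, with the
  determinant of the spanning vectors in the numerator. It reduces metric properties of Moebius maps
  to linear algebra.\<close>

lemma dist_homog:
  assumes "(x, y) \<noteq> 0" "(x', y') \<noteq> 0"
  shows "dist (homog x y) (homog x' y') = 2 * norm (x * y' - x' * y) / (norm (x, y) * norm (x', y'))"
proof -
  have sq: "sqrt (1 + (norm (u / v))\<^sup>2) = norm (u, v) / norm v" if "v \<noteq> 0" for u v :: complex
  proof -
    have "1 + (norm (u / v))\<^sup>2 = ((norm u)\<^sup>2 + (norm v)\<^sup>2) / (norm v)\<^sup>2"
      using that by (simp add: norm_divide power_divide add_divide_distrib)
    thus ?thesis by (simp add: norm_Pair real_sqrt_divide)
  qed
  have inf: "dist (homog u v) Infty = 2 * norm (u * 0 - w * v) / (norm (u, v) * norm (w, 0::complex))"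
    if "v \<noteq> 0" "w \<noteq> 0" for u v w
    using that by (simp add: homog_def dist_Finite_Infty sq norm_mult divide_simps)
  show ?thesis
  proof (cases "y = 0"; cases "y' = 0")
    assume "y = 0" "y' = 0"
    thus ?thesis by (simp add: homog_def)
  next
    assume y: "y \<noteq> 0" "y' = 0"
    hence "x' \<noteq> 0" using assms by (simp add: zero_prod_def)
    thus ?thesis using inf[OF y(1), of x' x] y by (simp add: homog_def)
  next
    assume y: "y = 0" "y' \<noteq> 0"
    hence "x \<noteq> 0" using assms by (simp add: zero_prod_def)
    thus ?thesis using inf[OF y(2), of x x'] y by (simp add: homog_def dist_commute mult.commute norm_minus_commute)
  next
    assume y: "y \<noteq> 0" "y' \<noteq> 0"
    have "x / y - x' / y' = (x * y' - x' * y) / (y * y')" using y by (simp add: divide_simps)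
    hence "dist (homog x y) (homog x' y') = 2 * norm ((x * y' - x' * y) / (y * y')) /
        ((norm (x, y) / norm y) * (norm (x', y') / norm y'))"
      using y by (simp only: homog_def dist_Finite_Finite sq[OF y(1)] sq[OF y(2)] if_False)
    thus ?thesis using y by (simp add: norm_divide norm_mult)
  qed
qed

lemma homog_eq_iff:
  assumes "(x, y) \<noteq> 0" "(x', y') \<noteq> 0"
  shows "homog x y = homog x' y' \<longleftrightarrow> x * y' - x' * y = 0"
  using dist_homog[OF assms] assms dist_eq_0_iff[of "homog x y" "homog x' y'"] by simp

lemma dist_Finite_norm_Pair: "dist (Finite k) (Finite l) = 2 * norm (k - l) / (norm (k, 1::complex) * norm (l, 1::complex))"
proof -
  have "Finite z = homog z 1" for z by (simp add: homog_def)
  thus ?thesis by (simp add: dist_homog zero_prod_def)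
qed

locale moebius =
  fixes p q r s :: complex
  assumes det: "p * s - q * r \<noteq> 0"
begin

text \<open>Only finite arguments occur. The image of infinity is \<open>homog p r\<close>; it plays
  the part of the omitted value.\<close>

definition M :: "complex \<Rightarrow> ext_complex" where
  "M k = homog (p * k + q) (r * k + s)"

definition K :: real where
  "K = (norm p + norm q + norm r + norm s)\<^sup>2 / norm (p * s - q * r)"

lemma nonzero: "(p * k + q, r * k + s) \<noteq> 0"
proof
  assume "(p * k + q, r * k + s) = 0"
  hence "p * k + q = 0" "r * k + s = 0" by (simp_all add: zero_prod_def)
  moreover have "p * s - q * r = p * (r * k + s) - r * (p * k + q)" by (simp add: algebra_simps)
  ultimately show False using det by simp
qed

lemma K_pos: "K > 0"
proof -
  have "norm p + norm q + norm r + norm s \<noteq> 0"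
    using det by (smt (verit) norm_ge_zero norm_eq_zero mult_zero_left diff_self)
  thus ?thesis unfolding K_def using det by simp
qed

text \<open>The second bound is the first one for the adjugate matrix, which maps
  \<open>(p * k + q, r * k + s)\<close> to the determinant times (k, 1). Its entries are the same up
  to sign and position, so one S serves both, and \<open>K\<close> is a Lipschitz constant in both
  directions.\<close>

lemma norm_bounds:
  defines "S \<equiv> norm p + norm q + norm r + norm s"
  shows "norm (p * k + q, r * k + s) \<le> S * norm (k, 1::complex)"
    and "norm (p * s - q * r) * norm (k, 1::complex) \<le> S * norm (p * k + q, r * k + s)"
proof -
  have n: "norm x \<le> norm (x, y)" "norm y \<le> norm (x, y)" for x y :: complex
    by (rule norm_fst_le norm_snd_le)+
  have lin: "norm (a * x + b * y, c * x + d * y) \<le> (norm a + norm b + norm c + norm d) * norm (x, y)"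
    for a b c d x y :: complex
  proof -
    have "norm (a * x + b * y, c * x + d * y) \<le> norm (a * x + b * y) + norm (c * x + d * y)"
      by (rule norm_Pair_le)
    also have "\<dots> \<le> (norm a * norm x + norm b * norm y) + (norm c * norm x + norm d * norm y)"
      by (intro add_mono norm_triangle_le) (auto simp: norm_mult)
    also have "\<dots> \<le> (norm a * norm (x, y) + norm b * norm (x, y)) + (norm c * norm (x, y) + norm d * norm (x, y))"
      by (intro add_mono mult_left_mono n) auto
    finally show ?thesis by (simp add: algebra_simps)
  qed
  show "norm (p * k + q, r * k + s) \<le> S * norm (k, 1::complex)"
    using lin[of p k q 1 r s] by (simp add: S_def)
  have "norm (p * s - q * r) * norm (k, 1::complex) = norm ((p * s - q * r) * k, p * s - q * r)"
  proof -
    have "norm (c * k, c) = norm c * norm (k, 1::complex)" for c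
    proof -
      have "norm (c * k, c) = sqrt ((norm c)\<^sup>2 * ((norm k)\<^sup>2 + 1))"
        by (simp add: norm_Pair norm_mult power_mult_distrib algebra_simps)
      also have "\<dots> = norm c * norm (k, 1::complex)" by (simp add: norm_Pair real_sqrt_mult)
      finally show ?thesis .
    qed
    thus ?thesis by simp
  qed
  also have "((p * s - q * r) * k, p * s - q * r) =
      (s * (p * k + q) + (- q) * (r * k + s), (- r) * (p * k + q) + p * (r * k + s))"
    by (simp add: algebra_simps)
  also have "norm \<dots> \<le> S * norm (p * k + q, r * k + s)"
    using lin[of s "p * k + q" "- q" "r * k + s" "- r" p] by (simp add: S_def algebra_simps)
  finally show "norm (p * s - q * r) * norm (k, 1::complex) \<le> S * norm (p * k + q, r * k + s)" .
qed

lemma dist_M: "dist (M k) (M l) =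
    2 * norm (p * s - q * r) * norm (k - l) / (norm (p * k + q, r * k + s) * norm (p * l + q, r * l + s))"
proof -
  have "(p * k + q) * (r * l + s) - (p * l + q) * (r * k + s) = (p * s - q * r) * (k - l)"
    by (simp add: algebra_simps)
  thus ?thesis unfolding M_def dist_homog[OF nonzero nonzero] by (simp add: norm_mult)
qed

lemma dist_M_le: "dist (M k) (M l) \<le> K * dist (Finite k) (Finite l)"
  and dist_Finite_le_M: "dist (Finite k) (Finite l) \<le> K * dist (M k) (M l)"
proof -
  define S d where "S = norm p + norm q + norm r + norm s" and "d = norm (p * s - q * r)"
  define nk nl mk ml where "nk = norm (k, 1::complex)" and "nl = norm (l, 1::complex)"
    and "mk = norm (p * k + q, r * k + s)" and "ml = norm (p * l + q, r * l + s)"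
  have d: "d > 0" using det by (simp add: d_def)
  have pos: "nk > 0" "nl > 0" "mk > 0" "ml > 0"
    unfolding nk_def nl_def mk_def ml_def using nonzero by (auto simp: zero_prod_def)
  have S: "S \<ge> 0" by (simp add: S_def)
  have up: "mk * ml \<le> (S * nk) * (S * nl)"
    unfolding mk_def ml_def nk_def nl_def S_def by (intro mult_mono norm_bounds(1)) auto
  have lo: "(d * nk) * (d * nl) \<le> (S * mk) * (S * ml)"
    unfolding mk_def ml_def nk_def nl_def S_def d_def by (intro mult_mono norm_bounds(2)) auto
  have M: "dist (M k) (M l) = 2 * d * norm (k - l) / (mk * ml)"
    unfolding dist_M d_def mk_def ml_def ..
  have F: "dist (Finite k) (Finite l) = 2 * norm (k - l) / (nk * nl)"
    unfolding dist_Finite_norm_Pair nk_def nl_def ..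
  have K: "K = S\<^sup>2 / d" by (simp add: K_def S_def d_def)
  have "d / (mk * ml) \<le> S\<^sup>2 / d / (nk * nl)"
    using lo d pos by (simp add: divide_simps power2_eq_square mult_ac)
  from mult_left_mono[OF this, of "2 * norm (k - l)"]
  show "dist (M k) (M l) \<le> K * dist (Finite k) (Finite l)"
    unfolding M F K by (simp add: mult_ac)
  have "1 / (nk * nl) \<le> S\<^sup>2 / (mk * ml)"
    using up pos by (simp add: divide_simps power2_eq_square mult_ac)
  from mult_left_mono[OF this, of "2 * norm (k - l)"]
  have "dist (Finite k) (Finite l) \<le> 2 * norm (k - l) * (S\<^sup>2 / (mk * ml))"
    unfolding F by simp
  also have "\<dots> = K * dist (M k) (M l)"
    unfolding M K using d by simp
  finally show "dist (Finite k) (Finite l) \<le> K * dist (M k) (M l)" .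
qed

lemma M_inverse:
  assumes "a = homog x y" "(x, y) \<noteq> 0" "a \<noteq> homog p r"
  shows "p * y - r * x \<noteq> 0" "M ((s * x - q * y) / (p * y - r * x)) = a"
proof -
  have pr: "(p, r) \<noteq> 0" using det by (auto simp: zero_prod_def)
  show ne: "p * y - r * x \<noteq> 0"
    using homog_eq_iff[OF assms(2) pr] assms(1,3) by (auto simp: algebra_simps)
  define c where "c = (p * s - q * r) / (p * y - r * x)"
  define k where "k = (s * x - q * y) / (p * y - r * x)"
  have "c \<noteq> 0" using det ne by (simp add: c_def)
  moreover have "p * k + q = c * x" "r * k + s = c * y"
    using ne unfolding k_def c_def by (simp_all add: divide_simps) (simp_all add: algebra_simps)
  ultimately show "M ((s * x - q * y) / (p * y - r * x)) = a"
    unfolding M_def k_def[symmetric] by (simp add: homog_mult assms(1))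
qed

end

text \<open>Three vectors in the plane satisfy A v1 + B v3 = C v2, where the coefficients are the
  2x2 determinants. With columns B v3 and A v1 the matrix sends infinity to a3, 0 to a1 and, by the
  relation, 1 to a2. Its determinant is -ABC, which is nonzero by distinctness.\<close>

lemma moebius_exists:
  assumes "distinct [a1, a2, a3]"
  obtains p q r s where "moebius p q r s" "moebius.M p q r s 0 = a1" "moebius.M p q r s 1 = a2" "homog p r = a3"
proof -
  obtain x1 y1 where 1: "a1 = homog x1 y1" "(x1, y1) \<noteq> 0" by (rule ext_complex_eq_homog)
  obtain x2 y2 where 2: "a2 = homog x2 y2" "(x2, y2) \<noteq> 0" by (rule ext_complex_eq_homog)
  obtain x3 y3 where 3: "a3 = homog x3 y3" "(x3, y3) \<noteq> 0" by (rule ext_complex_eq_homog)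
  define A B C where "A = x2 * y3 - x3 * y2" and "B = x1 * y2 - x2 * y1" and "C = x1 * y3 - x3 * y1"
  have ne: "A \<noteq> 0" "B \<noteq> 0" "C \<noteq> 0"
    using assms 1 2 3 homog_eq_iff[OF 2(2) 3(2)] homog_eq_iff[OF 1(2) 2(2)] homog_eq_iff[OF 1(2) 3(2)]
    by (auto simp: A_def B_def C_def)
  have sum: "B * x3 + A * x1 = C * x2" "B * y3 + A * y1 = C * y2"
    by (simp_all add: A_def B_def C_def algebra_simps)
  have "(B * x3) * (A * y1) - (A * x1) * (B * y3) = - (A * B * C)"
    by (simp add: C_def algebra_simps)
  hence mo: "moebius (B * x3) (A * x1) (B * y3) (A * y1)"
    using ne by unfold_locales simp
  show ?thesis
  proof (rule that[OF mo])
    show "moebius.M (B * x3) (A * x1) (B * y3) (A * y1) 0 = a1"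
      using ne by (simp add: moebius.M_def[OF mo] homog_mult 1)
    show "moebius.M (B * x3) (A * x1) (B * y3) (A * y1) 1 = a2"
      using ne by (simp add: moebius.M_def[OF mo] sum homog_mult 2)
    show "homog (B * x3) (B * y3) = a3"
      using ne by (simp add: homog_mult 3)
  qed
qed

section \<open>Meromorphic functions omitting a value\<close>

lemma nicely_meromorphic_eventually_analytic:
  assumes "f nicely_meromorphic_on D" "open D" "z \<in> D"
  shows "\<forall>\<^sub>F w in at z. w \<in> D \<and> \<not> is_pole f w \<and> f analytic_on {w}"
proof -
  have "f meromorphic_on {z}"
    using assms by (auto simp: nicely_meromorphic_on_def intro: meromorphic_on_subset)
  hence "\<forall>\<^sub>F w in at z. \<not> is_pole f w"
    by (intro eventually_not_pole meromorphic_on_isolated_singularity)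
  moreover have "\<forall>\<^sub>F w in at z. w \<in> D"
    using assms(2,3) by (rule eventually_at_in_open')
  ultimately show ?thesis
    by eventually_elim (use nicely_meromorphic_on_imp_analytic_at[OF assms(1)] in auto)
qed

lemma isCont_ext_val:
  assumes "f nicely_meromorphic_on D" "open D" "z \<in> D"
  shows "isCont (ext_val f) z"
proof -
  note ev = nicely_meromorphic_eventually_analytic[OF assms]
  have "((\<lambda>w. dist (ext_val f w) (ext_val f z)) \<longlongrightarrow> 0) (at z)"
  proof (cases "is_pole f z")
    case True
    hence lim: "filterlim f at_infinity (at z)" by (simp add: is_pole_def)
    show ?thesis
    proof (rule Lim_null_comparison)
      have "\<forall>\<^sub>F w in at z. norm (f w) > 0"
        using lim by (metis filterlim_at_infinity_imp_norm_at_top filterlim_at_top_dense)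
      with ev show "\<forall>\<^sub>F w in at z. norm (dist (ext_val f w) (ext_val f z)) \<le> 2 * norm (inverse (f w))"
        by eventually_elim
           (use True dist_Finite_Infty_le in \<open>auto simp: ext_val_def norm_inverse divide_inverse\<close>)
      have "((\<lambda>w. inverse (f w)) \<longlongrightarrow> 0) (at z)"
        using filterlim_compose[OF tendsto_inverse_0 lim] .
      from tendsto_mult[OF tendsto_const[of 2] tendsto_norm[OF this]]
      show "((\<lambda>w. 2 * norm (inverse (f w))) \<longlongrightarrow> 0) (at z)" by simp
    qed
  next
    case False
    hence "(f \<longlongrightarrow> f z) (at z)" using assms by (auto simp: nicely_meromorphic_on_def)
    from tendsto_mult[OF tendsto_const[of 2] tendsto_norm[OF tendsto_diff[OF this tendsto_const[of "f z"]]]]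
    have lim: "((\<lambda>w. 2 * norm (f w - f z)) \<longlongrightarrow> 0) (at z)" by simp
    show ?thesis
    proof (rule Lim_null_comparison[OF _ lim])
      show "\<forall>\<^sub>F w in at z. norm (dist (ext_val f w) (ext_val f z)) \<le> 2 * norm (f w - f z)"
        using ev by eventually_elim (use False dist_Finite_le in \<open>auto simp: ext_val_def\<close>)
    qed
  qed
  thus ?thesis unfolding isCont_def by (rule iffD2[OF tendsto_dist_iff])
qed

context moebius
begin

text \<open>k is the inverse Moebius map applied to f. It is finite because f omits the image of
  infinity, and the poles of f become removable singularities of k.\<close>

lemma holomorphic_lift:
  assumes f: "f nicely_meromorphic_on B" "open B" and omit: "\<And>z. z \<in> B \<Longrightarrow> ext_val f z \<noteq> homog p r"
  shows "\<exists>k. k holomorphic_on B \<and> (\<forall>z\<in>B. ext_val f z = M (k z))"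
proof -
  \<comment> \<open>The value at a pole is the preimage of infinity. There r is nonzero, since
    infinity is taken and hence differs from the omitted value.\<close>
  define k where "k z = (if is_pole f z then - (s / r) else (s * f z - q) / (p - r * f z))" for z
  have fin: "p - r * f z \<noteq> 0" "M ((s * f z - q) / (p - r * f z)) = ext_val f z"
    if "z \<in> B" "\<not> is_pole f z" for z
    using M_inverse[of "ext_val f z" "f z" 1] omit[OF that(1)] that(2)
    by (auto simp: ext_val_def homog_def zero_prod_def)
  have inf: "r \<noteq> 0" "M (- (s / r)) = ext_val f z" if "z \<in> B" "is_pole f z" for z
    using M_inverse[of "ext_val f z" 1 0] omit[OF that(1)] that(2)
    by (auto simp: ext_val_def homog_def zero_prod_def)
  have hol: "k field_differentiable at z" if z: "z \<in> B" for z
  proof -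
    obtain e where e: "e > 0" "ball z e \<subseteq> B"
        "\<And>w. w \<in> ball z e - {z} \<Longrightarrow> \<not> is_pole f w \<and> f analytic_on {w}"
    proof -
      have "\<forall>\<^sub>F w in at z. w \<in> B \<and> \<not> is_pole f w \<and> f analytic_on {w}"
        by (rule nicely_meromorphic_eventually_analytic[OF f z])
      then obtain e where "e > 0" "\<And>w. w \<noteq> z \<Longrightarrow> dist w z < e \<Longrightarrow> w \<in> B \<and> \<not> is_pole f w \<and> f analytic_on {w}"
        unfolding eventually_at by blast
      thus ?thesis using z by (intro that[of e]) (auto simp: dist_commute subset_iff, metis)
    qed
    have "k holomorphic_on (ball z e - {z})"
    proof -
      have "f analytic_on (ball z e - {z})"
        using e(3) analytic_on_analytic_at by blast
      moreover have "p - r * f w \<noteq> 0" if "w \<in> ball z e - {z}" for w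
        by (rule fin(1)) (use e(2) e(3)[OF that] that in auto)
      ultimately have "(\<lambda>w. (s * f w - q) / (p - r * f w)) holomorphic_on (ball z e - {z})"
        by (intro holomorphic_intros analytic_imp_holomorphic)
      thus ?thesis
        by (rule holomorphic_transform) (use e(3) in \<open>auto simp: k_def\<close>)
    qed
    moreover have "(k \<longlongrightarrow> k z) (at z)"
    proof (cases "is_pole f z")
      case True
      have lim: "filterlim f at_infinity (at z)" using True by (simp add: is_pole_def)
      have "((\<lambda>w. inverse (f w)) \<longlongrightarrow> 0) (at z)"
        using filterlim_compose[OF tendsto_inverse_0 lim] .
      \<comment> \<open>Dividing through by f expresses k in terms of 1/f, which tends to 0 at the
        pole.\<close>
      hence "((\<lambda>w. (s - q * inverse (f w)) / (p * inverse (f w) - r)) \<longlongrightarrow> (s - q * 0) / (p * 0 - r)) (at z)"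
        using inf(1)[OF z True] by (intro tendsto_intros) auto
      moreover have "\<forall>\<^sub>F w in at z. (s - q * inverse (f w)) / (p * inverse (f w) - r) = k w"
      proof -
        have "\<forall>\<^sub>F w in at z. norm (f w) > 0"
          using lim by (metis filterlim_at_infinity_imp_norm_at_top filterlim_at_top_dense)
        moreover have "\<forall>\<^sub>F w in at z. w \<in> ball z e - {z}"
          using e(1) by (intro eventually_at_in_open) auto
        ultimately show ?thesis
        proof eventually_elim
          case (elim w)
          have "f w \<noteq> 0" using elim by auto
          hence "(s * f w - q) / (p - r * f w) = ((s - q * inverse (f w)) * f w) / ((p * inverse (f w) - r) * f w)"
            by (simp add: algebra_simps)
          also have "\<dots> = (s - q * inverse (f w)) / (p * inverse (f w) - r)"
            using \<open>f w \<noteq> 0\<close> by simp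
          finally show ?case using e(3)[OF elim(2)] by (simp add: k_def)
        qed
      qed
      ultimately have "(k \<longlongrightarrow> (s - q * 0) / (p * 0 - r)) (at z)"
        by (rule Lim_transform_eventually)
      moreover have "k z = (s - q * 0) / (p * 0 - r)" using True by (simp add: k_def)
      ultimately show ?thesis by simp
    next
      case False
      hence "(f \<longlongrightarrow> f z) (at z)" using f z by (auto simp: nicely_meromorphic_on_def)
      hence "((\<lambda>w. (s * f w - q) / (p - r * f w)) \<longlongrightarrow> (s * f z - q) / (p - r * f z)) (at z)"
        using fin(1)[OF z False] by (intro tendsto_intros)
      moreover have "\<forall>\<^sub>F w in at z. (s * f w - q) / (p - r * f w) = k w"
        using nicely_meromorphic_eventually_analytic[OF f z]
        by eventually_elim (simp add: k_def)
      ultimately have "(k \<longlongrightarrow> (s * f z - q) / (p - r * f z)) (at z)"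
        by (rule Lim_transform_eventually)
      thus ?thesis using False by (simp add: k_def)
    qed
    hence "(k \<longlongrightarrow> k z') (at z' within ball z e)" if "z' \<in> {z}" for z'
      using that by (auto intro: Lim_at_imp_Lim_at_within)
    ultimately have "k holomorphic_on ball z e"
      by (intro no_isolated_singularity'[of "{z}" k "ball z e"]) auto
    thus ?thesis using e(1) holomorphic_on_imp_differentiable_at[of k "ball z e" z] by simp
  qed
  have "k holomorphic_on B"
    using hol by (simp add: holomorphic_on_def field_differentiable_at_within)
  moreover have "ext_val f z = M (k z)" if "z \<in> B" for z
    using fin(2)[OF that] inf(2)[OF that] by (simp add: k_def)
  ultimately show ?thesis by blast
qed

end

text \<open>The factorisation by \<open>zor_poly\<close> gives |f - c| = O(|w - z|^m) at a finite
  value and 1/|f| = O(|w - z|^m) at a pole, with m the order. If f is locally constant, the distance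
  is 0.\<close>

lemma dist_ext_val_le_of_mult:
  assumes f: "f nicely_meromorphic_on D" "open D" and z: "z \<in> a_points D f a"
    and mult: "a_point_mult f a z \<ge> enat n"
  shows "\<exists>C. \<forall>\<^sub>F w in at z. dist (ext_val f w) a \<le> C * norm (w - z) ^ n"
proof -
  have zD: "z \<in> D" and fz: "ext_val f z = a" using z by (auto simp: a_points_def)
  note ev = nicely_meromorphic_eventually_analytic[OF f zD]
  \<comment> \<open>The actual order may exceed n; inside the unit disc around z the higher power is
    the smaller one.\<close>
  have near: "\<forall>\<^sub>F w in at z. norm (w - z) ^ m \<le> norm (w - z) ^ n" if "n \<le> m" for m
  proof -
    have "\<forall>\<^sub>F w in at z. w \<in> ball z 1" by (intro eventually_at_in_open') auto
    thus ?thesis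
      by eventually_elim (use that in \<open>auto simp: dist_norm norm_minus_commute intro!: power_decreasing\<close>)
  qed
  have bdd: "\<exists>B>0. \<forall>\<^sub>F w in at z. norm (g w) \<le> B" if "g holomorphic_on cball z e" "e > 0" for g e
  proof -
    have "bounded (g ` cball z e)"
      using that by (intro compact_imp_bounded compact_continuous_image holomorphic_on_imp_continuous_on) auto
    then obtain B where B: "B > 0" "\<forall>x\<in>cball z e. norm (g x) \<le> B"
      unfolding bounded_pos by auto
    moreover have "\<forall>\<^sub>F w in at z. w \<in> ball z e" using that by (intro eventually_at_in_open') auto
    ultimately show ?thesis by (intro exI[of _ B] conjI) (auto elim!: eventually_mono)
  qed
  show ?thesis
  proof (cases a)
    case (Finite c)
    hence np: "\<not> is_pole f z" and fzc: "f z = c" using fz by (auto simp: ext_val_def split: if_splits)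
    show ?thesis
    proof (cases "\<forall>\<^sub>F w in at z. f w = c")
      case True
      have "\<forall>\<^sub>F w in at z. dist (ext_val f w) a \<le> 0 * norm (w - z) ^ n"
        using ev True by eventually_elim (simp add: ext_val_def Finite)
      thus ?thesis by blast
    next
      case False
      hence ord: "n \<le> nat (zorder (\<lambda>w. f w - c) z)"
        using mult by (simp add: a_point_mult_def Finite)
      have "f analytic_on {z}" by (rule nicely_meromorphic_on_imp_analytic_at[OF f(1) zD np])
      then obtain e where e: "e > 0" "f holomorphic_on ball z e" by (auto simp: analytic_at_ball)
      have hol: "(\<lambda>w. f w - c) holomorphic_on ball z e" using e(2) by (intro holomorphic_intros)
      have "\<exists>w\<in>ball z e. f w - c \<noteq> 0"
      proof (rule ccontr)
        assume *: "\<not> ?thesis"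
        have "\<forall>\<^sub>F w in at z. w \<in> ball z e" using e by (intro eventually_at_in_open') auto
        hence "\<forall>\<^sub>F w in at z. f w = c" by eventually_elim (use * in auto)
        thus False using False by blast
      qed
      from zorder_exist_zero[OF hol open_ball connected_ball _ this] e(1)
      obtain d where d: "d > 0" "zor_poly (\<lambda>w. f w - c) z holomorphic_on cball z d"
        "\<forall>w\<in>cball z d. f w - c = zor_poly (\<lambda>w. f w - c) z w * (w - z) ^ nat (zorder (\<lambda>w. f w - c) z)"
        by (metis centre_in_ball)
      obtain B where B: "B > 0" "\<forall>\<^sub>F w in at z. norm (zor_poly (\<lambda>w. f w - c) z w) \<le> B"
        using bdd[OF d(2,1)] by blast
      have "\<forall>\<^sub>F w in at z. w \<in> ball z d" using d by (intro eventually_at_in_open') auto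
      hence "\<forall>\<^sub>F w in at z. dist (ext_val f w) a \<le> (2 * B) * norm (w - z) ^ n"
        using ev near[OF ord] B(2)
      proof eventually_elim
        case (elim w)
        have "dist (ext_val f w) a \<le> 2 * norm (f w - c)"
          using elim dist_Finite_le by (simp add: ext_val_def Finite)
        also have "norm (f w - c) = norm (zor_poly (\<lambda>w. f w - c) z w) *
            norm (w - z) ^ nat (zorder (\<lambda>w. f w - c) z)"
          using d(3) elim by (simp add: norm_mult norm_power)
        also have "\<dots> \<le> B * norm (w - z) ^ n"
          using elim B(1) by (intro mult_mono) auto
        finally show ?case by simp
      qed
      thus ?thesis by blast
    qed
  next
    case Infty
    hence pole: "is_pole f z" using fz by (auto simp: ext_val_def split: if_splits)
    have ord: "n \<le> nat (- zorder f z)" using mult by (simp add: a_point_mult_def Infty)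
    obtain e where e: "e > 0" "f holomorphic_on ball z e - {z}"
    proof -
      obtain e where e: "e > 0" "\<And>w. w \<noteq> z \<Longrightarrow> dist w z < e \<Longrightarrow> f analytic_on {w}"
        using ev unfolding eventually_at by blast
      hence "f analytic_on ball z e - {z}"
        by (subst analytic_on_analytic_at) (auto simp: dist_commute)
      thus ?thesis using e(1) that analytic_imp_holomorphic by blast
    qed
    from zorder_exist_pole[OF e(2) open_ball _ pole] e(1)
    obtain d where d: "d > 0" "zor_poly f z holomorphic_on cball z d" "zor_poly f z z \<noteq> 0"
      "\<forall>w\<in>cball z d - {z}. f w = zor_poly f z w / (w - z) ^ nat (- zorder f z) \<and> zor_poly f z w \<noteq> 0"
      by (metis centre_in_ball)
    have "(\<lambda>w. inverse (zor_poly f z w)) holomorphic_on cball z d"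
      using d by (intro holomorphic_intros) (metis Diff_iff empty_iff insert_iff)+
    from bdd[OF this d(1)] obtain B where B: "B > 0" "\<forall>\<^sub>F w in at z. norm (inverse (zor_poly f z w)) \<le> B"
      by blast
    have "\<forall>\<^sub>F w in at z. w \<in> ball z d - {z}" using d by (intro eventually_at_in_open) auto
    hence "\<forall>\<^sub>F w in at z. dist (ext_val f w) a \<le> (2 * B) * norm (w - z) ^ n"
      using ev near[OF ord] B(2)
    proof eventually_elim
      case (elim w)
      have fw: "f w = zor_poly f z w / (w - z) ^ nat (- zorder f z)" "zor_poly f z w \<noteq> 0" "w \<noteq> z"
        using d(4) elim by auto
      hence "f w \<noteq> 0" by simp
      hence "dist (ext_val f w) a \<le> 2 * (1 / norm (f w))"
        using elim dist_Finite_Infty_le[of "f w"] by (simp add: ext_val_def Infty)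
      also have "1 / norm (f w) = norm (inverse (zor_poly f z w)) * norm (w - z) ^ nat (- zorder f z)"
        using fw(2,3) by (simp add: fw(1) norm_divide norm_power norm_inverse divide_simps)
      also have "\<dots> \<le> B * norm (w - z) ^ n"
        using elim B(1) by (intro mult_mono) auto
      finally show ?case by simp
    qed
    thus ?thesis by blast
  qed
qed

section \<open>Equi-Lipschitz estimates\<close>

text \<open>The target is only a metric space, so no mean value theorem applies. Bisection does: the
  estimate is additive over adjacent intervals, and it holds on every short interval around t by
  comparing both ends with t.\<close>

lemma Lipschitz_on_segment_from_local:
  fixes g :: "'a::real_normed_vector \<Rightarrow> 'b::metric_space"
  assumes "convex S" "x \<in> S" "y \<in> S"
    and loc: "\<And>u. u \<in> S \<Longrightarrow> \<forall>\<^sub>F v in at u. dist (g v) (g u) \<le> L * dist v u"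
  shows "dist (g x) (g y) \<le> L * dist x y"
proof -
  define \<gamma> where "\<gamma> t = x + t *\<^sub>R (y - x)" for t :: real
  have \<gamma>d: "dist (\<gamma> t) (\<gamma> u) = \<bar>t - u\<bar> * norm (y - x)" for t u
    by (simp add: \<gamma>_def dist_norm flip: scaleR_diff_left)
  have \<gamma>S: "\<gamma> t \<in> S" if "0 \<le> t" "t \<le> 1" for t
    using convexD_alt[OF assms(1,2,3) that] by (simp add: \<gamma>_def algebra_simps)
  have "dist (g (\<gamma> 0)) (g (\<gamma> 1)) \<le> L * norm (y - x) * (1 - 0)"
  proof (rule Bolzano[where P = "\<lambda>t u. dist (g (\<gamma> t)) (g (\<gamma> u)) \<le> L * norm (y - x) * (u - t)"])
    show "(0::real) \<le> 1" by simp
  next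
    fix a b c
    assume "dist (g (\<gamma> a)) (g (\<gamma> b)) \<le> L * norm (y - x) * (b - a)"
      "dist (g (\<gamma> b)) (g (\<gamma> c)) \<le> L * norm (y - x) * (c - b)"
    hence "dist (g (\<gamma> a)) (g (\<gamma> c)) \<le> L * norm (y - x) * (b - a) + L * norm (y - x) * (c - b)"
      using dist_triangle[of "g (\<gamma> a)" "g (\<gamma> c)" "g (\<gamma> b)"] by linarith
    thus "dist (g (\<gamma> a)) (g (\<gamma> c)) \<le> L * norm (y - x) * (c - a)"
      by (simp add: algebra_simps)
  next
    fix t :: real assume t: "0 \<le> t" "t \<le> 1"
    obtain d where d: "d > 0" "\<And>v. v \<noteq> \<gamma> t \<Longrightarrow> dist v (\<gamma> t) < d \<Longrightarrow> dist (g v) (g (\<gamma> t)) \<le> L * dist v (\<gamma> t)"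
      using loc[OF \<gamma>S[OF t]] unfolding eventually_at by blast
    \<comment> \<open>The summand 1 keeps the denominator positive when x = y.\<close>
    define d' where "d' = d / (norm (y - x) + 1)"
    have d': "d' > 0" using d(1) by (simp add: d'_def add_nonneg_pos)
    have near: "dist (g (\<gamma> u)) (g (\<gamma> t)) \<le> L * norm (y - x) * \<bar>u - t\<bar>" if "\<bar>u - t\<bar> < d'" for u
    proof (cases "\<gamma> u = \<gamma> t")
      case True
      hence "\<bar>u - t\<bar> * norm (y - x) = 0" using \<gamma>d[of u t] by simp
      thus ?thesis using True by auto
    next
      case False
      have "dist (\<gamma> u) (\<gamma> t) \<le> \<bar>u - t\<bar> * (norm (y - x) + 1)"
        by (simp add: \<gamma>d mult_left_mono)
      also have "\<dots> < d' * (norm (y - x) + 1)"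
        using that by (intro mult_strict_right_mono) (auto simp: add_nonneg_pos)
      also have "\<dots> = d" by (simp add: d'_def add_nonneg_eq_0_iff)
      finally have "dist (g (\<gamma> u)) (g (\<gamma> t)) \<le> L * dist (\<gamma> u) (\<gamma> t)" by (rule d(2)[OF False])
      thus ?thesis by (simp add: \<gamma>d mult_ac)
    qed
    have "\<forall>a b. a \<le> t \<and> t \<le> b \<and> b - a < d' \<longrightarrow> dist (g (\<gamma> a)) (g (\<gamma> b)) \<le> L * norm (y - x) * (b - a)"
    proof (intro allI impI)
      fix a b assume ab: "a \<le> t \<and> t \<le> b \<and> b - a < d'"
      have "dist (g (\<gamma> a)) (g (\<gamma> b)) \<le> dist (g (\<gamma> a)) (g (\<gamma> t)) + dist (g (\<gamma> b)) (g (\<gamma> t))"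
        by (rule dist_triangle2)
      also have "\<dots> \<le> L * norm (y - x) * \<bar>a - t\<bar> + L * norm (y - x) * \<bar>b - t\<bar>"
        using ab by (intro add_mono near) auto
      also have "\<dots> = L * norm (y - x) * (b - a)" using ab by (simp add: algebra_simps)
      finally show "dist (g (\<gamma> a)) (g (\<gamma> b)) \<le> L * norm (y - x) * (b - a)" .
    qed
    thus "\<exists>d>0. \<forall>a b. a \<le> t \<and> t \<le> b \<and> b - a < d \<longrightarrow>
        dist (g (\<gamma> a)) (g (\<gamma> b)) \<le> L * norm (y - x) * (b - a)" using d' by blast
  qed
  thus ?thesis by (simp add: \<gamma>_def dist_norm norm_minus_commute)
qed

lemma dist_Finite_holomorphic_le:
  assumes k: "k holomorphic_on S" "open S" "convex S" and xy: "x \<in> S" "y \<in> S"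
    and L: "L > 0" "\<And>z. z \<in> S \<Longrightarrow> norm (deriv k z) / (1 + (norm (k z))\<^sup>2) \<le> L"
  shows "dist (Finite (k x)) (Finite (k y)) \<le> 3 * L * dist x y"
proof (rule Lipschitz_on_segment_from_local[OF k(3) xy, of "\<lambda>z. Finite (k z)"])
  fix u assume u: "u \<in> S"
  define N where "N z = sqrt (1 + (norm (k z))\<^sup>2)" for z
  have N: "N z > 0" for z unfolding N_def by (simp add: add_pos_nonneg)
  have kd: "(k has_field_derivative deriv k u) (at u)" using k(1,2) u by (rule holomorphic_derivI)
  have kc: "(k \<longlongrightarrow> k u) (at u)" using holomorphic_on_imp_isCont[OF k(1,2) u] by (rule isContD)
  have "((\<lambda>v. (k v - k u) / (v - u)) \<longlongrightarrow> deriv k u) (at u)"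
    using kd by (simp add: has_field_derivative_iff)
  moreover have "(N \<longlongrightarrow> N u) (at u)" unfolding N_def by (intro tendsto_intros kc)
  ultimately have "((\<lambda>v. 2 * norm ((k v - k u) / (v - u)) / (N v * N u)) \<longlongrightarrow>
      2 * norm (deriv k u) / (N u * N u)) (at u)"
    using N[of u] by (intro tendsto_intros) auto
  \<comment> \<open>The chordal difference quotient tends to at most 2L. The factor 3 leaves the
    strict gap that lets the bound persist near u.\<close>
  moreover have "2 * norm (deriv k u) / (N u * N u) < 3 * L"
  proof -
    have "N u * N u = 1 + (norm (k u))\<^sup>2" by (simp add: N_def)
    thus ?thesis using L(1) L(2)[OF u] by simp
  qed
  ultimately have "\<forall>\<^sub>F v in at u. 2 * norm ((k v - k u) / (v - u)) / (N v * N u) < 3 * L"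
    by (rule order_tendstoD(2))
  moreover have "\<forall>\<^sub>F v in at u. v \<noteq> u" by (rule eventually_neq_at_within)
  ultimately show "\<forall>\<^sub>F v in at u. dist (Finite (k v)) (Finite (k u)) \<le> 3 * L * dist v u"
  proof eventually_elim
    case (elim v)
    have "dist (Finite (k v)) (Finite (k u)) = 2 * norm ((k v - k u) / (v - u)) / (N v * N u) * norm (v - u)"
      using elim by (simp add: dist_Finite_Finite N_def norm_divide)
    also have "\<dots> \<le> 3 * L * norm (v - u)" using elim by (intro mult_right_mono) auto
    finally show ?case by (simp add: dist_norm)
  qed
qed

text \<open>Needed at the 0-points and 1-points of the lift: the density has value 0 there, so the
  Schwarz estimate says nothing about the derivative.\<close>

lemma deriv_zero_of_order:
  assumes "k holomorphic_on S" "open S" "z \<in> S"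
    and ord: "\<forall>\<^sub>F w in at z. norm (k w - k z) \<le> C * norm (w - z) ^ n" "n \<ge> 2"
  shows "deriv k z = 0"
proof -
  have "((\<lambda>w. (k w - k z) / (w - z)) \<longlongrightarrow> 0) (at z)"
  proof (rule Lim_null_comparison)
    show "\<forall>\<^sub>F w in at z. norm ((k w - k z) / (w - z)) \<le> C * norm (w - z) ^ (n - 1)"
      using ord(1) eventually_neq_at_within[of z z]
    proof eventually_elim
      case (elim w)
      have "norm (w - z) ^ n = norm (w - z) ^ (n - 1) * norm (w - z)"
        using ord(2) by (metis One_nat_def Suc_1 Suc_le_D diff_Suc_1 power_Suc2)
      thus ?case using elim by (simp add: norm_divide divide_simps mult_ac)
    qed
    have "((\<lambda>w. C * norm (w - z) ^ (n - 1)) \<longlongrightarrow> C * norm (z - z) ^ (n - 1)) (at z)"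
      by (intro tendsto_intros)
    thus "((\<lambda>w. C * norm (w - z) ^ (n - 1)) \<longlongrightarrow> 0) (at z)" using ord(2) by (simp add: power_0_left)
  qed
  hence "(k has_field_derivative 0) (at z)" by (simp add: has_field_derivative_iff)
  thus ?thesis by (rule DERIV_imp_deriv)
qed

text \<open>The inverse of M is Lipschitz for the chordal metric, and near z the lift is bounded,
  where Euclidean distance is controlled by chordal distance.\<close>

lemma (in moebius) order_of_lift:
  assumes k: "k holomorphic_on S" "open S" "z \<in> S" and lift: "\<And>w. w \<in> S \<Longrightarrow> ext_val f w = M (k w)"
    and ord: "\<forall>\<^sub>F w in at z. dist (ext_val f w) (ext_val f z) \<le> C * norm (w - z) ^ n"
  shows "\<exists>C. \<forall>\<^sub>F w in at z. norm (k w - k z) \<le> C * norm (w - z) ^ n"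
proof -
  have "(k \<longlongrightarrow> k z) (at z)" using holomorphic_on_imp_isCont[OF k] by (rule isContD)
  from order_tendstoD(2)[OF tendsto_norm[OF this], of "norm (k z) + 1"]
  have "\<forall>\<^sub>F w in at z. norm (k w) < norm (k z) + 1" by simp
  hence "\<forall>\<^sub>F w in at z. norm (k w - k z) \<le> ((2 + norm (k z)) * (1 + norm (k z)) * K * C) * norm (w - z) ^ n"
    using ord eventually_at_in_open'[OF k(2,3)]
  proof eventually_elim
    case (elim w)
    have "norm (k w - k z) \<le> (1 + norm (k w)) * (1 + norm (k z)) * dist (Finite (k w)) (Finite (k z))"
      by (rule norm_diff_le_dist_Finite)
    also have "\<dots> \<le> (2 + norm (k z)) * (1 + norm (k z)) * (K * dist (M (k w)) (M (k z)))"
      using elim by (intro mult_mono dist_Finite_le_M) (auto intro: add_nonneg_nonneg)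
    also have "\<dots> \<le> (2 + norm (k z)) * (1 + norm (k z)) * (K * (C * norm (w - z) ^ n))"
      using elim lift[OF elim(3)] lift[OF k(3)] K_pos
      by (intro mult_left_mono) (auto intro: add_nonneg_nonneg)
    finally show ?case by (simp add: mult_ac)
  qed
  thus ?thesis by blast
qed

lemma omitting_family_equi_Lipschitz:
  assumes a: "distinct [a1, a2, a3]" and R: "R > 0"
  obtains L where "\<And>f x y. \<lbrakk>f nicely_meromorphic_on ball c R;
      \<And>z. z \<in> ball c R \<Longrightarrow> ext_val f z \<noteq> a3;
      \<And>z. z \<in> a_points (ball c R) f a1 \<Longrightarrow> a_point_mult f a1 z \<ge> 2;
      \<And>z. z \<in> a_points (ball c R) f a2 \<Longrightarrow> a_point_mult f a2 z \<ge> 3;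
      x \<in> ball c (R / 4); y \<in> ball c (R / 4)\<rbrakk>
    \<Longrightarrow> dist (ext_val f x) (ext_val f y) \<le> L * dist x y"
proof -
  obtain p q r s where mo: "moebius p q r s" and M: "moebius.M p q r s 0 = a1"
      "moebius.M p q r s 1 = a2" "homog p r = a3"
    using moebius_exists[OF a] by blast
  interpret moebius p q r s by (rule mo)
  \<comment> \<open>The Schwarz estimate is used on the disc of radius R/2. For |z - c| < R/4 its
    weight is at least 3R^2/16 >= R^2/6, so the pulled back density is at most 6 * 250 / R;
    comparison with the spherical density doubles this.\<close>
  define L where "L = 3000 / R"
  have L: "L > 0" using R by (simp add: L_def)
  show ?thesis
  proof (rule that[of "K * (3 * L)"])
    fix f x y
    assume f: "f nicely_meromorphic_on ball c R" and omit: "\<And>z. z \<in> ball c R \<Longrightarrow> ext_val f z \<noteq> a3"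
      and m1: "\<And>z. z \<in> a_points (ball c R) f a1 \<Longrightarrow> a_point_mult f a1 z \<ge> 2"
      and m2: "\<And>z. z \<in> a_points (ball c R) f a2 \<Longrightarrow> a_point_mult f a2 z \<ge> 3"
      and xy: "x \<in> ball c (R / 4)" "y \<in> ball c (R / 4)"
    obtain k where k: "k holomorphic_on ball c R" "\<And>z. z \<in> ball c R \<Longrightarrow> ext_val f z = M (k z)"
      using holomorphic_lift[OF f open_ball, unfolded M(3), OF omit] by blast
    have ord: "\<exists>C. \<forall>\<^sub>F w in at z. norm (k w - k z) \<le> C * norm (w - z) ^ n"
      if z: "z \<in> ball c R" and Mk: "M (k z) = a" and
        mult: "\<And>z. z \<in> a_points (ball c R) f a \<Longrightarrow> a_point_mult f a z \<ge> enat n"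
      for z a n
    proof -
      have "z \<in> a_points (ball c R) f a" using z Mk k(2) by (simp add: a_points_def)
      from dist_ext_val_le_of_mult[OF f open_ball this mult[OF this]]
      obtain C where "\<forall>\<^sub>F w in at z. dist (ext_val f w) (ext_val f z) \<le> C * norm (w - z) ^ n"
        using k(2)[OF z] Mk by auto
      from order_of_lift[OF k(1) open_ball z k(2) this] show ?thesis by blast
    qed
    have ord0: "\<exists>C. \<forall>\<^sub>F w in at z. norm (k w) \<le> C * norm (w - z) ^ 2" if "z \<in> ball c R" "k z = 0" for z
      using ord[OF that(1), of a1 2] that(2) M(1) m1 by (simp add: numeral_eq_enat)
    have ord1: "\<exists>C. \<forall>\<^sub>F w in at z. norm (k w - 1) \<le> C * norm (w - z) ^ 3" if "z \<in> ball c R" "k z = 1" for z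
      using ord[OF that(1), of a2 3] that(2) M(2) m2 by (simp add: numeral_eq_enat)
    have bound: "norm (deriv k z) / (1 + (norm (k z))\<^sup>2) \<le> L" if z: "z \<in> ball c (R / 4)" for z
    proof (cases "k z = 0 \<or> k z = 1")
      case True
      have zR: "z \<in> ball c R" using z R by auto
      have "deriv k z = 0"
      proof (cases "k z = 0")
        case True
        from ord0[OF zR True] obtain C where "\<forall>\<^sub>F w in at z. norm (k w) \<le> C * norm (w - z) ^ 2" by blast
        thus ?thesis using True by (intro deriv_zero_of_order[OF k(1) open_ball zR, of C 2]) auto
      next
        case False
        hence "k z = 1" using True by simp
        from ord1[OF zR this] obtain C where "\<forall>\<^sub>F w in at z. norm (k w - 1) \<le> C * norm (w - z) ^ 3" by blast
        thus ?thesis using \<open>k z = 1\<close> by (intro deriv_zero_of_order[OF k(1) open_ball zR, of C 3]) auto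
      qed
      thus ?thesis using L by simp
    next
      case False
      define u where "u = norm (deriv k z) * orbifold_density (k z)"
      have u0: "u \<ge> 0" by (simp add: u_def orbifold_density_nonneg)
      have "u * ((R / 2)\<^sup>2 - (norm (z - c))\<^sup>2) \<le> 500 * (R / 2)"
        unfolding u_def
        by (rule orbifold_schwarz_lemma[OF k(1) open_ball _ _ ord0 ord1]) (use R z in \<open>auto simp: cball_subset_ball_iff\<close>)
      moreover have "(R / 2)\<^sup>2 - (norm (z - c))\<^sup>2 \<ge> R\<^sup>2 / 6"
      proof -
        have "norm (z - c) \<le> R / 4" using z by (simp add: dist_norm norm_minus_commute)
        from power_mono[OF this, of 2] have "(norm (z - c))\<^sup>2 \<le> R\<^sup>2 / 16"
          by (simp add: power_divide)
        moreover have "(R / 2)\<^sup>2 = R\<^sup>2 / 4" by (simp add: power_divide)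
        ultimately show ?thesis using zero_le_power2[of R] by linarith
      qed
      hence "u * (R\<^sup>2 / 6) \<le> u * ((R / 2)\<^sup>2 - (norm (z - c))\<^sup>2)"
        using u0 by (rule mult_left_mono)
      ultimately have "u * (R\<^sup>2 / 6) \<le> 250 * R" by simp
      hence "u \<le> 1500 / R" using R by (simp add: field_simps power2_eq_square)
      have "norm (deriv k z) * (1 / (1 + (norm (k z))\<^sup>2)) \<le> norm (deriv k z) * (2 * orbifold_density (k z))"
        using False by (intro mult_left_mono orbifold_density_ge) auto
      also have "\<dots> = 2 * u" by (simp add: u_def)
      also have "\<dots> \<le> L" using \<open>u \<le> 1500 / R\<close> by (simp add: L_def)
      finally show ?thesis by simp
    qed
    have sub: "ball c (R / 4) \<subseteq> ball c R" using R by auto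
    have "dist (Finite (k x)) (Finite (k y)) \<le> 3 * L * dist x y"
      using holomorphic_on_subset[OF k(1) sub] xy L bound
      by (intro dist_Finite_holomorphic_le[of k "ball c (R / 4)"]) auto
    hence "K * dist (Finite (k x)) (Finite (k y)) \<le> K * (3 * L * dist x y)"
      using K_pos by (intro mult_left_mono) auto
    moreover have "dist (ext_val f x) (ext_val f y) \<le> K * dist (Finite (k x)) (Finite (k y))"
      using k(2) sub xy dist_M_le by (simp add: subset_iff)
    ultimately show "dist (ext_val f x) (ext_val f y) \<le> K * (3 * L) * dist x y"
      by (simp add: mult_ac)
  qed
qed

section \<open>Locally uniform limits on the sphere\<close>

lemma norm_stereo: "norm (stereo p) = 1"
proof (cases p)
  case (Finite z)
  define n where "n = (norm z)\<^sup>2"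
  have n: "n \<ge> 0" by (simp add: n_def)
  have nm: "norm (of_real (2 / (1 + n)) * z) = 2 / (1 + n) * norm z"
    using n by (simp only: norm_mult norm_of_real) simp
  have "(norm (stereo p))\<^sup>2 = (2 / (1 + n) * norm z)\<^sup>2 + ((n - 1) / (n + 1))\<^sup>2"
    unfolding Finite stereo_def ext_complex.case n_def[symmetric] norm_Pair nm by (simp add: power_divide)
  also have "\<dots> = (2 / (1 + n))\<^sup>2 * n + ((n - 1) / (n + 1))\<^sup>2"
    by (simp only: power_mult_distrib n_def)
  also have "\<dots> = 1"
    using n by (simp add: divide_simps power2_eq_square) (simp add: algebra_simps)
  finally show ?thesis by (metis norm_ge_zero one_power2 power2_eq_imp_eq zero_le_one)
qed (simp add: stereo_def norm_Pair)

lemma stereo_surj_on_sphere: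
  assumes "norm v = 1"
  obtains p where "v = stereo p"
proof -
  obtain x t where v: "v = (x, t)" by (cases v)
  have eq: "(norm x)\<^sup>2 + t\<^sup>2 = 1" using assms by (simp add: v norm_Pair)
  show ?thesis
  proof (cases "t = 1")
    case True
    thus ?thesis using eq that[of Infty] by (simp add: v stereo_def)
  next
    case False
    \<comment> \<open>Stereographic projection from the north pole (0, 1).\<close>
    define z where "z = x / of_real (1 - t)"
    have "(norm z)\<^sup>2 = (1 - t\<^sup>2) / (1 - t)\<^sup>2"
      using eq by (simp add: z_def norm_divide power_divide flip: of_real_diff)
    also have "\<dots> = (1 + t) / (1 - t)"
      using False by (simp add: divide_simps power2_eq_square) (simp add: algebra_simps)
    finally have nz: "(norm z)\<^sup>2 = (1 + t) / (1 - t)" .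
    have 1: "1 + (norm z)\<^sup>2 = 2 / (1 - t)" "((norm z)\<^sup>2 - 1) / ((norm z)\<^sup>2 + 1) = t"
      using False unfolding nz by (simp_all add: divide_simps)
    have "2 / (1 + (norm z)\<^sup>2) = 1 - t" unfolding 1 using False by simp
    moreover have "of_real (1 - t) * z = x"
      unfolding z_def using False by (metis eq_iff_diff_eq_0 nonzero_mult_div_cancel_left of_real_eq_0_iff times_divide_eq_right)
    ultimately have "v = stereo (Finite z)"
      unfolding v stereo_def ext_complex.case 1(2) by simp
    thus ?thesis by (rule that)
  qed
qed

text \<open>Limits of unit vectors are unit vectors and \<open>stereo\<close> is onto the sphere, so
  its image is closed. Completeness of the chordal metric rests on this.\<close>

lemma convergent_stereo_imp_convergent:
  assumes "convergent (\<lambda>n. stereo (X n))"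
  shows "convergent X"
proof -
  obtain l where l: "(\<lambda>n. stereo (X n)) \<longlonglongrightarrow> l" using assms by (auto simp: convergent_def)
  have "norm l = 1" using LIMSEQ_unique[OF tendsto_norm[OF l]] by (simp add: norm_stereo)
  then obtain p where p: "l = stereo p" by (rule stereo_surj_on_sphere)
  have "(\<lambda>n. dist (X n) p) \<longlonglongrightarrow> 0"
    using l unfolding p dist_ext_complex_def tendsto_dist_iff[of "\<lambda>n. stereo (X n)"] .
  hence "X \<longlonglongrightarrow> p" by (rule iffD2[OF tendsto_dist_iff])
  thus ?thesis by (auto simp: convergent_def)
qed

lemma Cauchy_ext_complex_imp_convergent:
  fixes X :: "nat \<Rightarrow> ext_complex"
  assumes "Cauchy X"
  shows "convergent X"
proof -
  have "Cauchy (\<lambda>n. stereo (X n))"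
    using assms unfolding Cauchy_def dist_ext_complex_def .
  thus ?thesis by (intro convergent_stereo_imp_convergent Cauchy_convergent)
qed

text \<open>An Arzela-Ascoli argument with a diagonal sequence over a countable dense set;
  \<open>stereo\<close> supplies the bounded vectors for the diagonal step. The threshold N may
  depend on z, since the sequence omits a value near z only eventually.\<close>

lemma locally_equi_Lipschitz_convergent_subsequence:
  fixes h :: "nat \<Rightarrow> complex \<Rightarrow> ext_complex"
  assumes equi: "\<And>z. z \<in> D \<Longrightarrow> \<exists>e>0. ball z e \<subseteq> D \<and>
      (\<exists>L N. \<forall>n\<ge>N. \<forall>x\<in>ball z e. \<forall>y\<in>ball z e. dist (h n x) (h n y) \<le> L * dist x y)"
  obtains r \<phi> where "strict_mono r"
    "\<And>z. z \<in> D \<Longrightarrow> \<exists>e>0. ball z e \<subseteq> D \<and> uniform_limit (ball z e) (\<lambda>n. h (r n)) \<phi> sequentially"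
proof -
  obtain T where T: "countable T" "T \<subseteq> D" "D \<subseteq> closure T" using separable[of D] by blast
  obtain r :: "nat \<Rightarrow> nat" where r: "strict_mono r" "\<And>x. x \<in> T \<Longrightarrow> \<exists>l. (\<lambda>n. stereo (h (r n) x)) \<longlonglongrightarrow> l"
    by (rule function_convergent_subsequence[OF T(1), of "\<lambda>n x. stereo (h n x)" 1]) (simp_all add: norm_stereo)
  have CT: "Cauchy (\<lambda>n. h (r n) x)" if "x \<in> T" for x
    using r(2)[OF that] convergent_stereo_imp_convergent[of "\<lambda>n. h (r n) x"]
    by (auto simp: convergent_def intro: LIMSEQ_imp_Cauchy)
  have UC: "\<exists>e>0. ball z e \<subseteq> D \<and> (\<forall>\<epsilon>>0. \<exists>N. \<forall>m\<ge>N. \<forall>n\<ge>N. \<forall>x\<in>ball z e. dist (h (r m) x) (h (r n) x) < \<epsilon>)"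
    if z: "z \<in> D" for z
  proof -
    obtain e L0 N where e: "e > 0" "ball z e \<subseteq> D" and
      L0: "\<And>n x y. n \<ge> N \<Longrightarrow> x \<in> ball z e \<Longrightarrow> y \<in> ball z e \<Longrightarrow> dist (h n x) (h n y) \<le> L0 * dist x y"
      using equi[OF z] by blast
    define L where "L = max L0 1"
    have L1: "L > 0" by (simp add: L_def)
    have L: "dist (h (r n) x) (h (r n) y) \<le> L * dist x y"
      if "n \<ge> N" "x \<in> ball z e" "y \<in> ball z e" for n x y
    proof -
      have "r n \<ge> N" using that(1) seq_suble[OF r(1), of n] by linarith
      from L0[OF this that(2,3)] have "dist (h (r n) x) (h (r n) y) \<le> L0 * dist x y" .
      also have "\<dots> \<le> L * dist x y" by (intro mult_right_mono) (auto simp: L_def)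
      finally show ?thesis .
    qed
    have "\<exists>N. \<forall>m\<ge>N. \<forall>n\<ge>N. \<forall>x\<in>ball z (e/2). dist (h (r m) x) (h (r n) x) < \<epsilon>" if \<epsilon>: "\<epsilon> > 0" for \<epsilon>
    proof -
      \<comment> \<open>Two Lipschitz steps to a point of the finite net and one Cauchy estimate at
        that point cost a third of \<epsilon> each.\<close>
      define d where "d = min (e / 2) (\<epsilon> / (3 * L))"
      have d: "d > 0" using e \<epsilon> L1 by (simp add: d_def)
      have "cball z (e/2) \<subseteq> (\<Union>t\<in>T. ball t d)"
      proof
        fix x assume x: "x \<in> cball z (e/2)"
        hence "x \<in> closure T" using e T(3) by (auto simp: subset_iff)
        then obtain t where "t \<in> T" "dist t x < d" using d by (meson closure_approachable)
        thus "x \<in> (\<Union>t\<in>T. ball t d)" by auto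
      qed
      then obtain T0 where T0: "T0 \<subseteq> T" "finite T0" "cball z (e/2) \<subseteq> (\<Union>t\<in>T0. ball t d)"
        using compactE_image[OF compact_cball, of T "\<lambda>t. ball t d" z "e/2"] by auto
      have "\<forall>t\<in>T0. \<exists>N. \<forall>m\<ge>N. \<forall>n\<ge>N. dist (h (r m) t) (h (r n) t) < \<epsilon> / 3"
        using CT T0(1) \<epsilon> unfolding Cauchy_def by (metis divide_pos_pos subsetD zero_less_numeral)
      then obtain Nt where Nt: "\<And>t m n. t \<in> T0 \<Longrightarrow> m \<ge> Nt t \<Longrightarrow> n \<ge> Nt t \<Longrightarrow> dist (h (r m) t) (h (r n) t) < \<epsilon> / 3"
        by metis
      define N' where "N' = Max (insert N (Nt ` T0))"
      have N': "N \<le> N'" "\<And>t. t \<in> T0 \<Longrightarrow> Nt t \<le> N'"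
        using T0(2) by (auto simp: N'_def)
      have "dist (h (r m) x) (h (r n) x) < \<epsilon>" if mn: "m \<ge> N'" "n \<ge> N'" and x: "x \<in> ball z (e/2)" for m n x
      proof -
        have "x \<in> cball z (e/2)" using x by simp
        with T0(3) have "x \<in> (\<Union>t\<in>T0. ball t d)" by blast
        then obtain t where t: "t \<in> T0" "dist t x < d" by auto
        have te: "t \<in> ball z e"
          using t(2) x dist_triangle[of z t x] by (auto simp: d_def dist_commute)
        have xe: "x \<in> ball z e" using x e(1) by auto
        have "L * dist x t \<le> L * d" using t(2) L1 by (intro mult_left_mono) (auto simp: dist_commute)
        also have "\<dots> \<le> L * (\<epsilon> / (3 * L))" using L1 by (intro mult_left_mono) (auto simp: d_def)
        also have "\<dots> = \<epsilon> / 3" using L1 by simp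
        finally have Ld: "L * dist x t \<le> \<epsilon> / 3" .
        have 1: "dist (h (r m) x) (h (r m) t) \<le> \<epsilon> / 3" "dist (h (r n) x) (h (r n) t) \<le> \<epsilon> / 3"
          using L[OF _ xe te, of m] L[OF _ xe te, of n] Ld mn N'(1) by linarith+
        have 2: "dist (h (r m) t) (h (r n) t) < \<epsilon> / 3"
          using Nt[OF t(1)] N'(2)[OF t(1)] mn by (meson le_trans)
        have "dist (h (r m) x) (h (r n) x) \<le> dist (h (r m) x) (h (r m) t) + dist (h (r m) t) (h (r n) x)"
          by (rule dist_triangle)
        also have "dist (h (r m) t) (h (r n) x) \<le> dist (h (r m) t) (h (r n) t) + dist (h (r n) x) (h (r n) t)"
          by (rule dist_triangle2)
        finally show ?thesis using 1 2 by linarith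
      qed
      thus ?thesis by blast
    qed
    thus ?thesis using e by (intro exI[of _ "e/2"]) auto
  qed
  \<comment> \<open>The subsequence is the same for all discs, so the local limits are pieces of one
    function.\<close>
  define \<phi> where "\<phi> x = lim (\<lambda>n. h (r n) x)" for x
  have "\<exists>e>0. ball z e \<subseteq> D \<and> uniform_limit (ball z e) (\<lambda>n. h (r n)) \<phi> sequentially" if z: "z \<in> D" for z
  proof -
    obtain e where e: "e > 0" "ball z e \<subseteq> D" and
      uc: "\<And>\<epsilon>. \<epsilon> > 0 \<Longrightarrow> \<exists>N. \<forall>m\<ge>N. \<forall>n\<ge>N. \<forall>x\<in>ball z e. dist (h (r m) x) (h (r n) x) < \<epsilon>"
      using UC[OF z] by blast
    have lim: "(\<lambda>n. h (r n) x) \<longlonglongrightarrow> \<phi> x" if x: "x \<in> ball z e" for x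
    proof -
      have "Cauchy (\<lambda>n. h (r n) x)"
        unfolding Cauchy_def using uc x by blast
      from Cauchy_ext_complex_imp_convergent[OF this] show ?thesis
        unfolding \<phi>_def by (simp add: convergent_LIMSEQ_iff)
    qed
    have "uniform_limit (ball z e) (\<lambda>n. h (r n)) \<phi> sequentially"
    proof (rule uniform_limitI)
      fix \<epsilon> :: real assume \<epsilon>: "\<epsilon> > 0"
      have "\<epsilon> / 2 > 0" using \<epsilon> by simp
      from uc[OF this] obtain N where N: "\<And>m n x. m \<ge> N \<Longrightarrow> n \<ge> N \<Longrightarrow> x \<in> ball z e \<Longrightarrow> dist (h (r m) x) (h (r n) x) < \<epsilon> / 2"
        by blast
      have "dist (h (r n) x) (\<phi> x) < \<epsilon>" if nx: "n \<ge> N" "x \<in> ball z e" for n x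
      proof -
        have "(\<lambda>m. dist (h (r n) x) (h (r m) x)) \<longlonglongrightarrow> dist (h (r n) x) (\<phi> x)"
          by (intro tendsto_intros lim nx)
        moreover have "\<forall>\<^sub>F m in sequentially. dist (h (r n) x) (h (r m) x) \<le> \<epsilon> / 2"
          using N[OF nx(1) _ nx(2)] by (auto simp: eventually_sequentially intro: less_imp_le)
        ultimately have "dist (h (r n) x) (\<phi> x) \<le> \<epsilon> / 2"
          by (rule tendsto_upperbound) simp
        thus ?thesis using \<epsilon> by linarith
      qed
      thus "\<forall>\<^sub>F n in sequentially. \<forall>x\<in>ball z e. dist (h (r n) x) (\<phi> x) < \<epsilon>"
        unfolding eventually_sequentially by blast
    qed
    thus ?thesis using e by blast
  qed
  thus ?thesis using that r(1) by blast
qed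

section \<open>Meromorphy of spherical limits\<close>

context moebius
begin

lemma pole_value_nonzero: "(p, r) \<noteq> 0"
  using det by (auto simp: zero_prod_def)

text \<open>The distance from M k to the image of infinity is inversely proportional to the norm of
  \<open>(p * k + q, r * k + s)\<close>, and that norm dominates |k| up to a constant.\<close>

lemma norm_le_of_dist_pole_value:
  assumes "\<eta> > 0"
  obtains B where "\<And>k. \<eta> \<le> dist (M k) (homog p r) \<Longrightarrow> norm k \<le> B"
proof -
  define S d where "S = norm p + norm q + norm r + norm s" and "d = norm (p * s - q * r)"
  have d: "d > 0" using det by (simp add: d_def)
  show ?thesis
  proof (rule that[of "S * (2 * d / (\<eta> * norm (p, r))) / d"])
    fix k assume far: "\<eta> \<le> dist (M k) (homog p r)"
    define n where "n = norm (p * k + q, r * k + s)"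
    have n: "n > 0" "norm (p, r) > 0" using nonzero pole_value_nonzero by (simp_all add: n_def)
    have "(p * k + q) * r - p * (r * k + s) = - (p * s - q * r)" by (simp add: algebra_simps)
    hence "dist (M k) (homog p r) = 2 * d / (n * norm (p, r))"
      unfolding M_def dist_homog[OF nonzero pole_value_nonzero] n_def d_def by (metis norm_minus_cancel)
    hence "n \<le> 2 * d / (\<eta> * norm (p, r))" using far n assms by (simp add: field_simps)
    hence *: "S * n \<le> S * (2 * d / (\<eta> * norm (p, r)))" by (intro mult_left_mono) (auto simp: S_def)
    have "d * norm k \<le> d * norm (k, 1::complex)"
      using norm_fst_le[of k "1::complex"] d by simp
    also have "\<dots> \<le> S * n" unfolding S_def d_def n_def by (rule norm_bounds(2))
    also note *
    finally show "norm k \<le> S * (2 * d / (\<eta> * norm (p, r))) / d"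
      unfolding pos_le_divide_eq[OF d] by (simp only: mult.commute)
  qed
qed

lemma M_surj: assumes "a \<noteq> homog p r" obtains k where "M k = a"
proof -
  obtain x y where "a = homog x y" "(x, y) \<noteq> 0" by (rule ext_complex_eq_homog)
  from M_inverse(2)[OF this assms] show ?thesis by (rule that)
qed

text \<open>Near z the functions and their limit stay away from the image of infinity, so their
  lifts are uniformly bounded. On bounded sets spherical convergence is Euclidean convergence of the
  lifts, and uniform limits of holomorphic functions are holomorphic.\<close>

lemma limit_lift:
  assumes e: "e > 0" and f: "\<And>n. fs n nicely_meromorphic_on ball z e"
    and lim: "uniform_limit (ball z e) (\<lambda>n. ext_val (fs n)) \<phi> sequentially"
    and \<phi>z: "\<phi> z \<noteq> homog p r"
  obtains d \<kappa> where "d > 0" "d \<le> e" "\<kappa> holomorphic_on ball z d" "\<And>w. w \<in> ball z d \<Longrightarrow> \<phi> w = M (\<kappa> w)"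
proof -
  \<comment> \<open>One third of \<eta> is spent on the variation of \<phi> near z, one on the
    approximation by \<open>fs n\<close>, and one remains as distance from
    \<open>homog p r\<close>.\<close>
  define \<eta> where "\<eta> = dist (\<phi> z) (homog p r)"
  have \<eta>: "\<eta> > 0" using \<phi>z by (simp add: \<eta>_def)
  have "continuous_on (ball z e) \<phi>"
    by (rule uniform_limit_theorem[OF _ lim])
       (auto intro!: always_eventually continuous_at_imp_continuous_on isCont_ext_val[OF f open_ball])
  then obtain d1 where d1: "d1 > 0" "\<And>w. w \<in> ball z e \<Longrightarrow> dist w z < d1 \<Longrightarrow> dist (\<phi> w) (\<phi> z) < \<eta> / 3"
    using e \<eta> unfolding continuous_on_iff by (metis centre_in_ball divide_pos_pos zero_less_numeral)
  define d where "d = min d1 e / 2"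
  have d: "d > 0" "2 * d \<le> d1" "2 * d \<le> e" using d1 e by (auto simp: d_def)
  have sub: "ball z (2 * d) \<subseteq> ball z e" using d(3) by (rule subset_ball)
  have "\<eta> / 3 > 0" using \<eta> by simp
  from uniform_limitD[OF lim this]
  obtain N where N: "\<And>n w. n \<ge> N \<Longrightarrow> w \<in> ball z e \<Longrightarrow> dist (ext_val (fs n) w) (\<phi> w) < \<eta> / 3"
    unfolding eventually_sequentially by blast
  have near: "dist (\<phi> w) (\<phi> z) < \<eta> / 3" if "w \<in> ball z (2 * d)" for w
    using that d(2,3) by (intro d1(2)) (auto simp: dist_commute)
  have far\<phi>: "\<eta> / 3 \<le> dist (\<phi> w) (homog p r)" if "w \<in> ball z (2 * d)" for w
    using \<eta> near[OF that] dist_triangle[of "\<phi> z" "homog p r" "\<phi> w"]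
    unfolding \<eta>_def dist_commute[of "\<phi> z" "\<phi> w"] by linarith
  have farf: "\<eta> / 3 \<le> dist (ext_val (fs n) w) (homog p r)" if "w \<in> ball z (2 * d)" "n \<ge> N" for w n
  proof -
    have "dist (ext_val (fs n) w) (\<phi> w) < \<eta> / 3" using N that sub by blast
    thus ?thesis
      using near[OF that(1)] dist_triangle[of "\<phi> z" "homog p r" "\<phi> w"]
        dist_triangle[of "\<phi> w" "homog p r" "ext_val (fs n) w"]
      by (simp add: \<eta>_def dist_commute)
  qed
  obtain B where B: "\<And>k. \<eta> / 3 \<le> dist (M k) (homog p r) \<Longrightarrow> norm k \<le> B"
    using norm_le_of_dist_pole_value[of "\<eta> / 3"] \<eta> by auto
  have "\<exists>k. k holomorphic_on ball z (2 * d) \<and> (\<forall>w\<in>ball z (2 * d). ext_val (fs n) w = M (k w))" if "n \<ge> N" for n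
  proof -
    have omit: "ext_val (fs n) w \<noteq> homog p r" if "w \<in> ball z (2 * d)" for w
      using farf[OF that \<open>n \<ge> N\<close>] \<eta> by auto
    show ?thesis
      by (rule holomorphic_lift[OF nicely_meromorphic_on_subset[OF f sub] open_ball]) (rule omit)
  qed
  then obtain k where k: "\<And>n. n \<ge> N \<Longrightarrow> k n holomorphic_on ball z (2 * d)"
      "\<And>n w. n \<ge> N \<Longrightarrow> w \<in> ball z (2 * d) \<Longrightarrow> ext_val (fs n) w = M (k n w)" by metis
  have "\<exists>x. M x = \<phi> w" if "w \<in> ball z (2 * d)" for w
    using M_surj[of "\<phi> w"] far\<phi>[OF that] \<eta> by fastforce
  \<comment> \<open>A pointwise choice of preimages, with no regularity yet; holomorphy comes from
    the uniform convergence below.\<close>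
  then obtain \<kappa> where \<kappa>: "\<And>w. w \<in> ball z (2 * d) \<Longrightarrow> M (\<kappa> w) = \<phi> w" by metis
  have close: "norm (k n w - \<kappa> w) \<le> ((1 + B) * (1 + B) * K) * dist (ext_val (fs n) w) (\<phi> w)"
    if "n \<ge> N" "w \<in> ball z (2 * d)" for n w
  proof -
    have b: "norm (k n w) \<le> B" "norm (\<kappa> w) \<le> B"
      using B farf[OF that(2,1)] far\<phi>[OF that(2)] k(2)[OF that] \<kappa>[OF that(2)] by simp_all
    have B0: "B \<ge> 0" using b(1) norm_ge_zero order_trans by blast
    have "norm (k n w - \<kappa> w) \<le> (1 + norm (k n w)) * (1 + norm (\<kappa> w)) * dist (Finite (k n w)) (Finite (\<kappa> w))"
      by (rule norm_diff_le_dist_Finite)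
    also have "\<dots> \<le> (1 + B) * (1 + B) * (K * dist (M (k n w)) (M (\<kappa> w)))"
      using b B0 by (intro mult_mono dist_Finite_le_M) auto
    finally show ?thesis using k(2)[OF that] \<kappa>[OF that(2)] by (simp add: mult.assoc)
  qed
  \<comment> \<open>Halving the radius provides a closed disc inside the domain of the lifts, as the
    limit theorem needs continuity up to the boundary.\<close>
  have subd: "cball z d \<subseteq> ball z (2 * d)" using d by auto
  have ul: "uniform_limit (cball z d) k \<kappa> sequentially"
  proof (rule uniform_limitI)
    fix \<epsilon> :: real assume \<epsilon>: "\<epsilon> > 0"
    define C where "C = (1 + B) * (1 + B) * K"
    have C: "C \<ge> 0" unfolding C_def using K_pos by (intro mult_nonneg_nonneg[OF zero_le_square]) simp
    have "\<forall>\<^sub>F n in sequentially. \<forall>w\<in>ball z e. dist (ext_val (fs n) w) (\<phi> w) < \<epsilon> / (C + 1)"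
      using uniform_limitD[OF lim, of "\<epsilon> / (C + 1)"] \<epsilon> C by auto
    thus "\<forall>\<^sub>F n in sequentially. \<forall>w\<in>cball z d. dist (k n w) (\<kappa> w) < \<epsilon>"
      using eventually_ge_at_top[of N]
    proof eventually_elim
      case (elim n)
      show ?case
      proof
        fix w assume w: "w \<in> cball z d"
        have "dist (ext_val (fs n) w) (\<phi> w) < \<epsilon> / (C + 1)" using elim w subd sub by blast
        hence "(C + 1) * dist (ext_val (fs n) w) (\<phi> w) < \<epsilon>"
          using C by (simp add: field_simps)
        moreover have "norm (k n w - \<kappa> w) \<le> C * dist (ext_val (fs n) w) (\<phi> w)"
          unfolding C_def using elim w subd by (intro close) auto
        ultimately show "dist (k n w) (\<kappa> w) < \<epsilon>"
          unfolding dist_norm[of "k n w"] distrib_right mult_1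
          using zero_le_dist[of "ext_val (fs n) w" "\<phi> w"] by linarith
      qed
    qed
  qed
  have ev: "\<forall>\<^sub>F n in sequentially. continuous_on (cball z d) (k n) \<and> k n holomorphic_on ball z d"
    using eventually_ge_at_top[of N]
  proof eventually_elim
    case (elim n)
    from k(1)[OF elim] have "k n holomorphic_on cball z d" using subd by (rule holomorphic_on_subset)
    thus ?case using holomorphic_on_imp_continuous_on holomorphic_on_subset[OF _ ball_subset_cball] by blast
  qed
  have "\<kappa> holomorphic_on ball z d"
    by (rule holomorphic_uniform_limit[OF ev ul]) auto
  thus ?thesis using that[of d \<kappa>] d \<kappa> by auto
qed

end

text \<open>The value 0 at \<open>Infty\<close> agrees with the convention that a nicely meromorphic
  function is 0 at its poles.\<close>

definition finite_part :: "ext_complex \<Rightarrow> complex" where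
  "finite_part p = (case p of Finite w \<Rightarrow> w | Infty \<Rightarrow> 0)"

text \<open>A finite value at z is handled in the identity chart, an infinite one in the chart 1/w.
  In the latter the lift vanishes at z: either identically nearby, which is the first alternative,
  or with an isolated zero, which is a pole of the limit.\<close>

lemma spherical_limit_local_alternative:
  assumes e: "e > 0" and f: "\<And>n. fs n nicely_meromorphic_on ball z e"
    and lim: "uniform_limit (ball z e) (\<lambda>n. ext_val (fs n)) \<phi> sequentially"
  shows "(\<forall>\<^sub>F w in nhds z. \<phi> w = Infty) \<or>
    ((\<forall>\<^sub>F w in at z. \<phi> w \<noteq> Infty) \<and> (\<lambda>w. finite_part (\<phi> w)) nicely_meromorphic_on {z} \<and>
      \<phi> z = ext_val (\<lambda>w. finite_part (\<phi> w)) z)"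
proof (cases "\<phi> z = Infty")
  case False
  interpret moebius 1 0 0 1 by unfold_locales simp
  have M: "M k = Finite k" for k by (simp add: M_def homog_def)
  have "\<phi> z \<noteq> homog 1 0" using False by (simp add: homog_def)
  from limit_lift[OF e f lim this] obtain d \<kappa> where
    d: "d > 0" "\<kappa> holomorphic_on ball z d" "\<And>w. w \<in> ball z d \<Longrightarrow> \<phi> w = M (\<kappa> w)" by blast
  have "(\<lambda>w. finite_part (\<phi> w)) holomorphic_on ball z d"
    using d(2) by (rule holomorphic_transform) (simp add: d(3) M finite_part_def)
  hence an: "(\<lambda>w. finite_part (\<phi> w)) analytic_on {z}"
    using d(1) by (auto simp: analytic_at_ball)
  have "\<forall>\<^sub>F w in at z. w \<in> ball z d" using d(1) by (intro eventually_at_in_open') auto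
  hence "\<forall>\<^sub>F w in at z. \<phi> w \<noteq> Infty" by eventually_elim (simp add: d(3) M)
  moreover have "\<phi> z = ext_val (\<lambda>w. finite_part (\<phi> w)) z"
    using analytic_at_imp_no_pole[OF an] False
    by (cases "\<phi> z") (auto simp: ext_val_def finite_part_def)
  ultimately show ?thesis using analytic_on_imp_nicely_meromorphic_on[OF an] by blast
next
  case True
  interpret moebius 0 1 1 0 by unfold_locales simp
  have M: "M k = (if k = 0 then Infty else Finite (1 / k))" for k by (simp add: M_def homog_def)
  have "\<phi> z \<noteq> homog 0 1" using True by (simp add: homog_def)
  from limit_lift[OF e f lim this] obtain d \<kappa> where
    d: "d > 0" "\<kappa> holomorphic_on ball z d" "\<And>w. w \<in> ball z d \<Longrightarrow> \<phi> w = M (\<kappa> w)" by blast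
  have zd: "z \<in> ball z d" using d(1) by simp
  have \<kappa>z: "\<kappa> z = 0" using d(3)[OF zd] True by (simp add: M split: if_splits)
  show ?thesis
  proof (cases "\<forall>w\<in>ball z d. \<kappa> w = 0")
    case z: True
    have "\<forall>\<^sub>F w in nhds z. w \<in> ball z d" using zd by (intro eventually_nhds_in_open) auto
    hence "\<forall>\<^sub>F w in nhds z. \<phi> w = Infty" by eventually_elim (use z in \<open>simp add: d(3) M\<close>)
    thus ?thesis by blast
  next
    case False
    then obtain b where b: "b \<in> ball z d" "\<kappa> b \<noteq> 0" by blast
    obtain c where c: "c > 0" "ball z c \<subseteq> ball z d" "\<And>w. w \<in> ball z c - {z} \<Longrightarrow> \<kappa> w \<noteq> 0"
      using isolated_zeros[OF d(2) open_ball connected_ball zd \<kappa>z b] by metis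
    have evc: "\<forall>\<^sub>F w in at z. w \<in> ball z c - {z}" using c(1) by (intro eventually_at_in_open) auto
    hence ev: "\<forall>\<^sub>F w in at z. inverse (\<kappa> w) = finite_part (\<phi> w)"
    proof eventually_elim
      case (elim w)
      hence "\<phi> w = M (\<kappa> w)" using d(3) c(2) by blast
      thus ?case using c(3)[OF elim] by (simp add: M finite_part_def inverse_eq_divide)
    qed
    have "\<forall>\<^sub>F w in at z. \<phi> w \<noteq> Infty"
      using evc
    proof eventually_elim
      case (elim w)
      hence "\<phi> w = M (\<kappa> w)" using d(3) c(2) by blast
      thus ?case using c(3)[OF elim] by (simp add: M)
    qed
    moreover have pole: "is_pole (\<lambda>w. finite_part (\<phi> w)) z"
    proof -
      have "(\<kappa> \<longlongrightarrow> 0) (at z)"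
        using holomorphic_on_imp_isCont[OF d(2) open_ball zd] \<kappa>z by (simp add: isCont_def)
      moreover have "\<forall>\<^sub>F w in at z. \<kappa> w \<noteq> 0" using evc by eventually_elim (rule c(3))
      ultimately have "filterlim \<kappa> (at 0) (at z)" by (simp add: filterlim_at)
      hence "is_pole (\<lambda>w. inverse (\<kappa> w)) z"
        unfolding is_pole_def by (rule filterlim_compose[OF filterlim_inverse_at_infinity])
      thus ?thesis using is_pole_cong[OF ev refl] by blast
    qed
    moreover have "(\<lambda>w. finite_part (\<phi> w)) meromorphic_on {z}"
    proof -
      have "\<kappa> analytic_on {z}" using d(1,2) by (auto simp: analytic_at_ball)
      hence "(\<lambda>w. inverse (\<kappa> w)) meromorphic_on {z}"
        by (intro meromorphic_intros analytic_on_imp_meromorphic_on)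
      moreover have "(\<lambda>w. inverse (\<kappa> w)) meromorphic_on {z} \<longleftrightarrow> (\<lambda>w. finite_part (\<phi> w)) meromorphic_on {z}"
        by (rule meromorphic_on_cong) (use ev in auto)
      ultimately show ?thesis by blast
    qed
    moreover have "finite_part (\<phi> z) = 0" by (simp add: True finite_part_def)
    ultimately show ?thesis using True by (auto simp: nicely_meromorphic_on_def ext_val_def)
  qed
qed

text \<open>The points with \<phi> infinite nearby and the points with \<phi> finite on a punctured
  neighbourhood give two open sets that cover D and do not meet in it. Connectedness leaves only one
  of them.\<close>

lemma spherical_limit_meromorphic_or_Infty:
  assumes D: "connected D" and f: "\<And>n. fs n nicely_meromorphic_on D"
    and lim: "\<And>z. z \<in> D \<Longrightarrow> \<exists>e>0. ball z e \<subseteq> D \<and> uniform_limit (ball z e) (\<lambda>n. ext_val (fs n)) \<phi> sequentially"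
  shows "(\<exists>h. h nicely_meromorphic_on D \<and> (\<forall>z\<in>D. \<phi> z = ext_val h z)) \<or> (\<forall>z\<in>D. \<phi> z = Infty)"
proof -
  define h where "h w = finite_part (\<phi> w)" for w
  define A where "A = {z. \<forall>\<^sub>F w in nhds z. \<phi> w = Infty}"
  define B where "B = {z. \<forall>\<^sub>F w in at z. \<phi> w \<noteq> Infty}"
  have alt: "z \<in> A \<or> (z \<in> B \<and> h nicely_meromorphic_on {z} \<and> \<phi> z = ext_val h z)" if z: "z \<in> D" for z
  proof -
    obtain e where e: "e > 0" "ball z e \<subseteq> D" "uniform_limit (ball z e) (\<lambda>n. ext_val (fs n)) \<phi> sequentially"
      using lim[OF z] by blast
    from spherical_limit_local_alternative[OF e(1) nicely_meromorphic_on_subset[OF f e(2)] e(3)]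
    show ?thesis unfolding A_def B_def h_def[abs_def] by simp
  qed
  have "open A"
    unfolding open_subopen[of A]
  proof
    fix z assume "z \<in> A"
    then obtain S where S: "open S" "z \<in> S" "\<And>w. w \<in> S \<Longrightarrow> \<phi> w = Infty"
      unfolding A_def eventually_nhds by auto
    hence "S \<subseteq> A" unfolding A_def eventually_nhds by blast
    thus "\<exists>T. open T \<and> z \<in> T \<and> T \<subseteq> A" using S by blast
  qed
  have "open (interior B)" by simp
  have B: "z \<in> interior B" if "z \<in> D" "z \<notin> A" for z
  proof -
    have "\<forall>\<^sub>F w in at z. \<phi> w \<noteq> Infty" using alt[OF that(1)] that(2) by (simp add: B_def)
    then obtain S where S: "open S" "z \<in> S" "\<And>w. w \<in> S \<Longrightarrow> w \<noteq> z \<Longrightarrow> \<phi> w \<noteq> Infty"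
      unfolding eventually_at_topological by blast
    have "S \<subseteq> B"
    proof
      fix w assume w: "w \<in> S"
      show "w \<in> B"
      proof (cases "w = z")
        case True
        thus ?thesis using \<open>\<forall>\<^sub>F w in at z. \<phi> w \<noteq> Infty\<close> by (simp add: B_def)
      next
        case False
        have "\<forall>\<^sub>F u in at w. u \<in> S - {z}"
          using S(1) w False by (intro eventually_at_in_open') auto
        thus ?thesis unfolding B_def by (auto elim!: eventually_mono dest: S(3))
      qed
    qed
    thus ?thesis using S(1,2) by (meson interior_maximal subsetD)
  qed
  have disj: "A \<inter> interior B \<inter> D = {}"
  proof (rule ccontr)
    assume "A \<inter> interior B \<inter> D \<noteq> {}"
    then obtain z where "z \<in> A" "z \<in> B" using interior_subset by blast
    hence "\<forall>\<^sub>F w in at z. \<phi> w = Infty" "\<forall>\<^sub>F w in at z. \<phi> w \<noteq> Infty"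
      unfolding A_def B_def by (auto simp: eventually_nhds_conv_at)
    hence "\<forall>\<^sub>F w in at z. False" by eventually_elim simp
    thus False by simp
  qed
  consider "A \<inter> D = {}" | "interior B \<inter> D = {}"
    using connectedD[OF D \<open>open A\<close> \<open>open (interior B)\<close> disj] B by blast
  thus ?thesis
  proof cases
    case 1
    have "\<And>z. z \<in> D \<Longrightarrow> h nicely_meromorphic_on {z} \<and> \<phi> z = ext_val h z" using alt 1 by blast
    hence "h nicely_meromorphic_on D \<and> (\<forall>z\<in>D. \<phi> z = ext_val h z)"
      unfolding nicely_meromorphic_on_def meromorphic_on_meromorphic_at[of h D] by auto
    thus ?thesis by blast
  next
    case 2
    hence "z \<in> A" if "z \<in> D" for z using B[OF that] that by blast
    hence "\<phi> z = Infty" if "z \<in> D" for z using that eventually_nhds_x_imp_x unfolding A_def by blast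
    thus ?thesis by blast
  qed
qed

theorem theorem1p4:
  fixes D :: "complex set"
    and a1 a2 a3 a4 :: ext_complex
    and F G :: "(complex \<Rightarrow> complex) set"
  assumes "open D" and "connected D" and "D \<noteq> {}"
    and "distinct [a1, a2, a3, a4]"
    and "\<And>f. f \<in> F \<Longrightarrow> f nicely_meromorphic_on D"
    and "\<And>g. g \<in> G \<Longrightarrow> g nicely_meromorphic_on D"
    and "\<And>f z. f \<in> F \<Longrightarrow> z \<in> a_points D f a1 \<Longrightarrow> a_point_mult f a1 z \<ge> 2"
    and "\<And>f z. f \<in> F \<Longrightarrow> z \<in> a_points D f a2 \<Longrightarrow> a_point_mult f a2 z \<ge> 3"
    and "normal_family D G"
    and "\<And>f. f \<in> F \<Longrightarrow> \<exists>g\<in>G. shares_partially D f g a3 \<and> shares_partially D f g a4"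
  shows "normal_family D F"
  unfolding normal_family_def
proof (intro allI impI)
  fix fs :: "nat \<Rightarrow> complex \<Rightarrow> complex"
  assume "range fs \<subseteq> F"
  hence fF: "fs n \<in> F" for n by auto
  obtain gs where gs: "\<And>n. gs n \<in> G" "\<And>n. shares_partially D (fs n) (gs n) a3"
      "\<And>n. shares_partially D (fs n) (gs n) a4"
    using assms(10)[OF fF] by metis
  have "range gs \<subseteq> G" using gs(1) by auto
  then obtain r \<gamma> where r: "strict_mono r" and lim: "spherically_locally_uniform_limit D (gs \<circ> r) \<gamma>"
    and \<gamma>: "(\<exists>h. h nicely_meromorphic_on D \<and> (\<forall>z\<in>D. \<gamma> z = ext_val h z)) \<or> (\<forall>z\<in>D. \<gamma> z = Infty)"
    using assms(9) unfolding normal_family_def by blast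
  \<comment> \<open>Continuity keeps the limit of the g's away from the chosen value on a whole
    disc, not only at its centre.\<close>
  have cont: "continuous_on D \<gamma>"
  proof -
    from \<gamma> obtain \<gamma>' where "continuous_on D \<gamma>'" "\<forall>z\<in>D. \<gamma> z = \<gamma>' z"
    proof
      assume "\<exists>h. h nicely_meromorphic_on D \<and> (\<forall>z\<in>D. \<gamma> z = ext_val h z)"
      then obtain h where h: "h nicely_meromorphic_on D" "\<forall>z\<in>D. \<gamma> z = ext_val h z" by blast
      have "continuous_on D (ext_val h)"
        by (intro continuous_at_imp_continuous_on ballI isCont_ext_val[OF h(1) assms(1)])
      thus ?thesis using h(2) that by blast
    next
      assume "\<forall>z\<in>D. \<gamma> z = Infty"
      thus ?thesis using that[of "\<lambda>_. Infty"] by simp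
    qed
    thus ?thesis using continuous_on_cong[OF refl, of D \<gamma> \<gamma>'] by simp
  qed
  define h where "h n = ext_val (fs (r n))" for n
  have equi: "\<exists>e>0. ball z e \<subseteq> D \<and>
      (\<exists>L N. \<forall>n\<ge>N. \<forall>x\<in>ball z e. \<forall>y\<in>ball z e. dist (h n x) (h n y) \<le> L * dist x y)"
    if z: "z \<in> D" for z
  proof -
    \<comment> \<open>The limit of the \<open>g\<close>s cannot take both values \<open>a3\<close> and \<open>a4\<close> at \<open>z\<close>, so near \<open>z\<close> the
      \<open>f\<close>s eventually omit one of them.\<close>
    obtain a where a: "distinct [a1, a2, a]" "\<gamma> z \<noteq> a" "\<And>n. shares_partially D (fs n) (gs n) a"
    proof (cases "\<gamma> z = a3")
      case True
      thus ?thesis using assms(4) gs(3) by (intro that[of a4]) auto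
    next
      case False
      thus ?thesis using assms(4) gs(2) by (intro that[of a3]) auto
    qed
    \<comment> \<open>An a-point of f near z would be one of g, putting a within \<eta> of \<gamma>
      w, which is itself within \<eta> of \<gamma> z. The sum stays strictly below the distance of a
      from \<gamma> z.\<close>
    define \<eta> where "\<eta> = dist (\<gamma> z) a / 2"
    have \<eta>: "\<eta> > 0" using a(2) by (simp add: \<eta>_def)
    obtain U where U: "open U" "z \<in> U" "U \<subseteq> D" "uniform_limit U (\<lambda>n. ext_val ((gs \<circ> r) n)) \<gamma> sequentially"
      using lim z unfolding spherically_locally_uniform_limit_def by blast
    obtain N where N: "\<And>n w. n \<ge> N \<Longrightarrow> w \<in> U \<Longrightarrow> dist (ext_val (gs (r n)) w) (\<gamma> w) < \<eta>"
      using uniform_limitD[OF U(4) \<eta>] unfolding eventually_sequentially by auto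
    obtain d where d: "d > 0" "\<And>w. w \<in> D \<Longrightarrow> dist w z < d \<Longrightarrow> dist (\<gamma> w) (\<gamma> z) < \<eta>"
      using cont z \<eta> unfolding continuous_on_iff by blast
    obtain d' where d': "d' > 0" "ball z d' \<subseteq> U" using U(1,2) by (meson openE)
    define R where "R = min d d'"
    have R: "R > 0" "ball z R \<subseteq> U" "ball z R \<subseteq> D" using d d' U(3) by (auto simp: R_def)
    obtain L where L: "\<And>f x y. \<lbrakk>f nicely_meromorphic_on ball z R;
      \<And>w. w \<in> ball z R \<Longrightarrow> ext_val f w \<noteq> a;
      \<And>w. w \<in> a_points (ball z R) f a1 \<Longrightarrow> a_point_mult f a1 w \<ge> 2;
      \<And>w. w \<in> a_points (ball z R) f a2 \<Longrightarrow> a_point_mult f a2 w \<ge> 3;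
      x \<in> ball z (R / 4); y \<in> ball z (R / 4)\<rbrakk>
      \<Longrightarrow> dist (ext_val f x) (ext_val f y) \<le> L * dist x y"
      using omitting_family_equi_Lipschitz[OF a(1) R(1), of z] by blast
    have Lip: "dist (h n x) (h n y) \<le> L * dist x y"
      if "n \<ge> N" "x \<in> ball z (R / 4)" "y \<in> ball z (R / 4)" for n x y
      unfolding h_def
    proof (rule L)
      show "fs (r n) nicely_meromorphic_on ball z R"
        using assms(5)[OF fF] R(3) by (rule nicely_meromorphic_on_subset)
      show "ext_val (fs (r n)) w \<noteq> a" if w: "w \<in> ball z R" for w
      proof
        assume "ext_val (fs (r n)) w = a"
        hence "w \<in> a_points D (fs (r n)) a" using w R(3) by (auto simp: a_points_def)
        hence "ext_val (gs (r n)) w = a"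
          using a(3)[of "r n"] by (auto simp: shares_partially_def a_points_def)
        hence "dist a (\<gamma> w) < \<eta>" using N[OF \<open>n \<ge> N\<close>] w R(2) by auto
        moreover have "dist (\<gamma> w) (\<gamma> z) < \<eta>"
          using w R(3) by (intro d(2)) (auto simp: R_def dist_commute)
        ultimately show False
          using dist_triangle[of "\<gamma> z" a "\<gamma> w"] by (simp add: \<eta>_def dist_commute)
      qed
      show "a_point_mult (fs (r n)) a1 w \<ge> 2" if "w \<in> a_points (ball z R) (fs (r n)) a1" for w
        using assms(7)[OF fF] that R(3) by (auto simp: a_points_def)
      show "a_point_mult (fs (r n)) a2 w \<ge> 3" if "w \<in> a_points (ball z R) (fs (r n)) a2" for w
        using assms(8)[OF fF] that R(3) by (auto simp: a_points_def)
    qed (use that in auto)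
    have "ball z (R / 4) \<subseteq> D" "R / 4 > 0" using R(1,3) by (auto simp: subset_iff)
    thus ?thesis using Lip by blast
  qed
  obtain q \<phi> where q: "strict_mono q" and
    \<phi>: "\<And>z. z \<in> D \<Longrightarrow> \<exists>e>0. ball z e \<subseteq> D \<and> uniform_limit (ball z e) (\<lambda>n. h (q n)) \<phi> sequentially"
    using locally_equi_Lipschitz_convergent_subsequence[OF equi] by blast
  have "spherically_locally_uniform_limit D (fs \<circ> (r \<circ> q)) \<phi>"
    unfolding spherically_locally_uniform_limit_def
  proof
    fix z assume z: "z \<in> D"
    obtain e where "e > 0" "ball z e \<subseteq> D" "uniform_limit (ball z e) (\<lambda>n. h (q n)) \<phi> sequentially"
      using \<phi>[OF z] by blast
    thus "\<exists>U. open U \<and> z \<in> U \<and> U \<subseteq> D \<and>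
        uniform_limit U (\<lambda>n. ext_val ((fs \<circ> (r \<circ> q)) n)) \<phi> sequentially"
      by (intro exI[of _ "ball z e"]) (auto simp: h_def)
  qed
  moreover have "(\<exists>h. h nicely_meromorphic_on D \<and> (\<forall>z\<in>D. \<phi> z = ext_val h z)) \<or> (\<forall>z\<in>D. \<phi> z = Infty)"
    by (rule spherical_limit_meromorphic_or_Infty[OF assms(2), of "\<lambda>n. fs (r (q n))"])
       (use assms(5) fF \<phi> in \<open>auto simp: h_def\<close>)
  moreover have "strict_mono (r \<circ> q)" using r q by (rule strict_mono_o)
  ultimately show "\<exists>r \<phi>. strict_mono r \<and> spherically_locally_uniform_limit D (fs \<circ> r) \<phi> \<and>
      ((\<exists>h. h nicely_meromorphic_on D \<and> (\<forall>z\<in>D. \<phi> z = ext_val h z)) \<or> (\<forall>z\<in>D. \<phi> z = Infty))"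
    by blast
qed

end
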